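(* Let $(C,\Delta,\varepsilon,\alpha)$ be a Hom-coalgebra over a field $k$ and let $\lambda,\nu\in k$. Then the linear map $$B: C\otimes C\to C\otimes C,\qquad a\otimes b\mapsto \lambda\,\varepsilon(a)\,b_1\otimes b_2+\nu\,\varepsilon(b)\,a_1\otimes a_2-\nu\,\alpha(a)\otimes\alpha(b)$$ is a solution of the Hom-Yang-Baxter equation (with respect to the twist map $\alpha$ on $C$). If, in addition, $\lambda,\nu\in k^{\ast}=k\setminus\{0\}$ and $\alpha$ is involutive (i.e. $\alpha\circ\alpha=\mathrm{id}_C$), then $B$ is invertible, with inverse given by $$B^{-1}: C\otimes C\to C\otimes C,\qquad a\otimes b\mapsto \frac{1}{\nu}\,\varepsilon(a)\,b_1\otimes b_2+\frac{1}{\lambda}\,\varepsilon(b)\,a_1\otimes a_2-\frac{1}{\nu}\,\alpha(a)\otimes\alpha(b).$$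
   Context: Throughout, $k$ is a fixed field; vector spaces, linear maps and tensor products are over $k$. Sweedler notation $\Delta(c)=c_1\otimes c_2$ (summation understood) is used, with $c_{11}\otimes c_{12}=\Delta(c_1)$, $c_{21}\otimes c_{22}=\Delta(c_2)$. A Hom-coalgebra is a quadruple $(C,\Delta,\varepsilon,\alpha)$ where $C$ is a $k$-linear space, $\Delta:C\to C\otimes C$ and $\varepsilon:C\to k$ are $k$-linear maps, and $\alpha:C\to C$ is a linear endomorphism, such that for all $c\in C$: $\alpha(c)_1\otimes\alpha(c)_2=\alpha(c_1)\otimes\alpha(c_2)$, $\varepsilon\circ\alpha=\varepsilon$, $\alpha(c_1)\otimes c_{21}\otimes c_{22}=c_{11}\otimes c_{12}\otimes\alpha(c_2)$, and $\varepsilon(c_1)c_2=c_1\varepsilon(c_2)=\alpha(c)$. Hom-Yang-Baxter equation (HYBE): given a vector space $V$ and a linear endomorphism $\alpha$ of $V$, a linear map $B:V\otimes V\to V\otimes V$ is a solution of the HYBE if $B$ commutes with $\alpha\otimes\alpha$, i.e. $(\alpha\otimes\alpha)\circ B=B\circ(\alpha\otimes\alpha)$, and $$(\alpha\otimes B)\circ(B\otimes\alpha)\circ(\alpha\otimes B)=(B\otimes\alpha)\circ(\alpha\otimes B)\circ(B\otimes\alpha)$$ as maps $V\otimes V\otimes V\to V\otimes V\otimes V$. *)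

theory Defs
  imports "HOL-Algebra.Module" "HOL-Algebra.AbelCoset"
begin

section \<open>Linear and bilinear maps\<close>

text \<open>
  A vector space over a field \<open>K\<close> is a \<open>module K V\<close> in the sense of HOL-Algebra. Everything is
  relative to carriers; the values of a linear map outside of the carrier are irrelevant, so maps
  are compared pointwise on carriers.
\<close>

definition linear_map ::
  "('a, 'm) ring_scheme \<Rightarrow> ('a, 'v, 'p) module_scheme \<Rightarrow> ('a, 'w, 'q) module_scheme \<Rightarrow> ('v \<Rightarrow> 'w) \<Rightarrow> bool"
  where
  "linear_map K V W f \<longleftrightarrow>
     f \<in> carrier V \<rightarrow> carrier W \<and>
     (\<forall>x\<in>carrier V. \<forall>y\<in>carrier V. f (x \<oplus>\<^bsub>V\<^esub> y) = f x \<oplus>\<^bsub>W\<^esub> f y) \<and>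
     (\<forall>c\<in>carrier K. \<forall>x\<in>carrier V. f (c \<odot>\<^bsub>V\<^esub> x) = c \<odot>\<^bsub>W\<^esub> f x)"

definition bilinear_map ::
  "('a, 'm) ring_scheme \<Rightarrow> ('a, 'v, 'p) module_scheme \<Rightarrow> ('a, 'w, 'q) module_scheme \<Rightarrow>
   ('a, 'u, 'r) module_scheme \<Rightarrow> ('v \<Rightarrow> 'w \<Rightarrow> 'u) \<Rightarrow> bool"
  where
  "bilinear_map K V W U f \<longleftrightarrow>
     (\<forall>w\<in>carrier W. linear_map K V U (\<lambda>v. f v w)) \<and> (\<forall>v\<in>carrier V. linear_map K W U (f v))"

definition self_module :: "('a, 'm) ring_scheme \<Rightarrow> ('a, 'a) module" where
  "self_module K =
     \<lparr>carrier = carrier K, mult = mult K, one = one K, zero = zero K, add = add K, smult = mult K\<rparr>"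

lemma linear_mapI:
  assumes "\<And>x. x \<in> carrier V \<Longrightarrow> f x \<in> carrier W"
    and "\<And>x y. x \<in> carrier V \<Longrightarrow> y \<in> carrier V \<Longrightarrow> f (x \<oplus>\<^bsub>V\<^esub> y) = f x \<oplus>\<^bsub>W\<^esub> f y"
    and "\<And>c x. c \<in> carrier K \<Longrightarrow> x \<in> carrier V \<Longrightarrow> f (c \<odot>\<^bsub>V\<^esub> x) = c \<odot>\<^bsub>W\<^esub> f x"
  shows "linear_map K V W f"
  using assms by (auto simp: linear_map_def)

lemma linear_mapD:
  assumes "linear_map K V W f"
  shows "x \<in> carrier V \<Longrightarrow> f x \<in> carrier W"
    and "x \<in> carrier V \<Longrightarrow> y \<in> carrier V \<Longrightarrow> f (x \<oplus>\<^bsub>V\<^esub> y) = f x \<oplus>\<^bsub>W\<^esub> f y"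
    and "c \<in> carrier K \<Longrightarrow> x \<in> carrier V \<Longrightarrow> f (c \<odot>\<^bsub>V\<^esub> x) = c \<odot>\<^bsub>W\<^esub> f x"
  using assms by (auto simp: linear_map_def)

lemma linear_map_zero:
  assumes "module K V" "module K W" "linear_map K V W f"
  shows "f \<zero>\<^bsub>V\<^esub> = \<zero>\<^bsub>W\<^esub>"
proof -
  interpret V: module K V by fact
  interpret W: module K W by fact
  have "f (\<zero>\<^bsub>K\<^esub> \<odot>\<^bsub>V\<^esub> \<zero>\<^bsub>V\<^esub>) = \<zero>\<^bsub>K\<^esub> \<odot>\<^bsub>W\<^esub> f \<zero>\<^bsub>V\<^esub>"
    by (rule linear_mapD(3)[OF assms(3)]) simp_all
  then show ?thesis using linear_mapD(1)[OF assms(3)] by simp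
qed

lemma linear_map_minus:
  assumes "module K V" "module K W" "linear_map K V W f" "x \<in> carrier V" "y \<in> carrier V"
  shows "f (x \<ominus>\<^bsub>V\<^esub> y) = f x \<ominus>\<^bsub>W\<^esub> f y"
proof -
  interpret V: module K V by fact
  interpret W: module K W by fact
  note D = linear_mapD[OF assms(3)]
  have "f (\<ominus>\<^bsub>V\<^esub> y) \<oplus>\<^bsub>W\<^esub> f y = \<zero>\<^bsub>W\<^esub>"
    using D(2)[of "\<ominus>\<^bsub>V\<^esub> y" y] assms linear_map_zero[OF assms(1-3)] by (simp add: V.M.l_neg)
  then have "f (\<ominus>\<^bsub>V\<^esub> y) = \<ominus>\<^bsub>W\<^esub> f y"
    using D(1) assms(5) by (metis V.M.a_inv_closed W.M.minus_equality)
  then show ?thesis using D(2) assms(4,5) by (simp add: a_minus_def)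
qed

lemma module_self_module:
  assumes "cring K" shows "module K (self_module K)"
proof -
  interpret cring K by fact
  have "\<exists>y\<in>carrier K. y \<oplus>\<^bsub>K\<^esub> x = \<zero>\<^bsub>K\<^esub>" if "x \<in> carrier K" for x
    using that l_neg a_inv_closed by blast
  then show ?thesis
    by (intro moduleI assms abelian_groupI)
      (auto simp: self_module_def l_distr r_distr m_assoc a_ac)
qed


section \<open>Free and quotient modules\<close>

text \<open>The fields \<open>mult\<close> and \<open>one\<close> of a module record play no role for modules.\<close>

definition free_module :: "('a, 'm) ring_scheme \<Rightarrow> 'x set \<Rightarrow> ('a, 'x \<Rightarrow> 'a) module" where
  "free_module K X =
     \<lparr>carrier = {f. (\<forall>x. f x \<in> carrier K) \<and> (\<forall>x. x \<notin> X \<longrightarrow> f x = \<zero>\<^bsub>K\<^esub>) \<and> finite {x. f x \<noteq> \<zero>\<^bsub>K\<^esub>}},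
      mult = undefined, one = undefined,
      zero = (\<lambda>x. \<zero>\<^bsub>K\<^esub>), add = (\<lambda>f g x. f x \<oplus>\<^bsub>K\<^esub> g x), smult = (\<lambda>c f x. c \<otimes>\<^bsub>K\<^esub> f x)\<rparr>"

definition free_gen :: "('a, 'm) ring_scheme \<Rightarrow> 'x \<Rightarrow> 'x \<Rightarrow> 'a" where
  "free_gen K x = (\<lambda>y. if y = x then \<one>\<^bsub>K\<^esub> else \<zero>\<^bsub>K\<^esub>)"

definition free_ext ::
  "('a, 'm) ring_scheme \<Rightarrow> ('a, 'u, 'r) module_scheme \<Rightarrow> ('x \<Rightarrow> 'u) \<Rightarrow> ('x \<Rightarrow> 'a) \<Rightarrow> 'u" where
  "free_ext K U f a = (\<Oplus>\<^bsub>U\<^esub>x\<in>{x. a x \<noteq> \<zero>\<^bsub>K\<^esub>}. a x \<odot>\<^bsub>U\<^esub> f x)"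

definition submodule_span ::
  "('a, 'm) ring_scheme \<Rightarrow> ('a, 'v, 'p) module_scheme \<Rightarrow> 'v set \<Rightarrow> 'v set" where
  "submodule_span K M R = \<Inter>{S. submodule S K M \<and> R \<subseteq> S}"

definition quot_module :: "('a, 'v, 'p) module_scheme \<Rightarrow> 'v set \<Rightarrow> ('a, 'v set) module" where
  "quot_module M N =
     \<lparr>carrier = a_rcosets\<^bsub>M\<^esub> N, mult = undefined, one = undefined,
      zero = N, add = (\<lambda>X Y. X <+>\<^bsub>M\<^esub> Y), smult = (\<lambda>c X. \<Union>x\<in>X. N +>\<^bsub>M\<^esub> (c \<odot>\<^bsub>M\<^esub> x))\<rparr>"

lemma module_free_module:
  assumes "cring K" shows "module K (free_module K X)"
proof -
  interpret cring K by fact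
  have fin: "finite {x. f x \<oplus>\<^bsub>K\<^esub> g x \<noteq> \<zero>\<^bsub>K\<^esub>}"
    if "finite {x. f x \<noteq> \<zero>\<^bsub>K\<^esub>}" "finite {x. g x \<noteq> \<zero>\<^bsub>K\<^esub>}" for f g :: "'c \<Rightarrow> 'a"
    by (rule finite_subset[OF _ finite_UnI[OF that]]) auto
  have fin': "finite {x. c \<otimes>\<^bsub>K\<^esub> f x \<noteq> \<zero>\<^bsub>K\<^esub>}"
    if "finite {x. f x \<noteq> \<zero>\<^bsub>K\<^esub>}" "c \<in> carrier K" for f :: "'c \<Rightarrow> 'a" and c
    by (rule finite_subset[OF _ that(1)]) (use that in auto)
  have neg: "\<exists>g\<in>carrier (free_module K X). g \<oplus>\<^bsub>free_module K X\<^esub> f = \<zero>\<^bsub>free_module K X\<^esub>"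
    if "f \<in> carrier (free_module K X)" for f
  proof (rule bexI[of _ "\<lambda>x. \<ominus>\<^bsub>K\<^esub> f x"])
    show "(\<lambda>x. \<ominus>\<^bsub>K\<^esub> f x) \<in> carrier (free_module K X)"
      using that by (auto simp: free_module_def intro: finite_subset[rotated])
  qed (use that in \<open>auto simp: free_module_def l_neg\<close>)
  show ?thesis
    by (intro moduleI assms abelian_groupI neg)
      (auto simp: free_module_def l_distr r_distr m_assoc a_ac fin fin' fun_eq_iff)
qed

lemma free_gen_closed:
  assumes "cring K" "x \<in> X" shows "free_gen K x \<in> carrier (free_module K X)"
proof -
  interpret cring K by fact
  show ?thesis using assms(2) by (auto simp: free_module_def free_gen_def)
qed

lemma free_ext_superset:
  assumes "module K U" "f \<in> X \<rightarrow> carrier U" "a \<in> carrier (free_module K X)"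
    "finite A" "A \<subseteq> X" "{x. a x \<noteq> \<zero>\<^bsub>K\<^esub>} \<subseteq> A"
  shows "free_ext K U f a = (\<Oplus>\<^bsub>U\<^esub>x\<in>A. a x \<odot>\<^bsub>U\<^esub> f x)"
proof -
  interpret U: module K U by fact
  have c: "a x \<in> carrier K" for x using assms(3) by (auto simp: free_module_def)
  show ?thesis unfolding free_ext_def
    by (rule U.add.finprod_mono_neutral_cong_left) (use assms c in \<open>auto simp: Pi_iff\<close>)
qed

lemma linear_map_free_ext:
  assumes "module K U" "f \<in> X \<rightarrow> carrier U"
  shows "linear_map K (free_module K X) U (free_ext K U f)"
proof -
  interpret U: module K U by fact
  let ?F = "free_module K X"
  interpret F: module K ?F by (rule module_free_module) (rule U.is_cring)
  have c: "a x \<in> carrier K" if "a \<in> carrier ?F" for a x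
    using that by (auto simp: free_module_def)
  have s: "finite {x. a x \<noteq> \<zero>\<^bsub>K\<^esub>}" "{x. a x \<noteq> \<zero>\<^bsub>K\<^esub>} \<subseteq> X" if "a \<in> carrier ?F" for a
    using that by (auto simp: free_module_def)
  have cl: "(\<lambda>x. a x \<odot>\<^bsub>U\<^esub> f x) \<in> A \<rightarrow> carrier U" if "a \<in> carrier ?F" "A \<subseteq> X" for a A
    using that assms(2) c by (auto simp: Pi_iff)
  show ?thesis
  proof (rule linear_mapI)
    fix a assume a: "a \<in> carrier ?F"
    show "free_ext K U f a \<in> carrier U" unfolding free_ext_def
      by (rule U.M.finsum_closed) (use a s cl in blast)
    fix b assume b: "b \<in> carrier ?F"
    let ?A = "{x. a x \<noteq> \<zero>\<^bsub>K\<^esub>} \<union> {x. b x \<noteq> \<zero>\<^bsub>K\<^esub>}"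
    have A: "finite ?A" "?A \<subseteq> X" using s a b by auto
    have ab: "a \<oplus>\<^bsub>?F\<^esub> b \<in> carrier ?F" using a b by simp
    have e: "(a \<oplus>\<^bsub>?F\<^esub> b) x = a x \<oplus>\<^bsub>K\<^esub> b x" for x by (simp add: free_module_def)
    have sab: "{x. (a \<oplus>\<^bsub>?F\<^esub> b) x \<noteq> \<zero>\<^bsub>K\<^esub>} \<subseteq> ?A" by (auto simp: e)
    have "free_ext K U f (a \<oplus>\<^bsub>?F\<^esub> b) = (\<Oplus>\<^bsub>U\<^esub>x\<in>?A. (a \<oplus>\<^bsub>?F\<^esub> b) x \<odot>\<^bsub>U\<^esub> f x)"
      by (rule free_ext_superset[OF assms ab A sab])
    also have "\<dots> = (\<Oplus>\<^bsub>U\<^esub>x\<in>?A. a x \<odot>\<^bsub>U\<^esub> f x \<oplus>\<^bsub>U\<^esub> b x \<odot>\<^bsub>U\<^esub> f x)"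
    proof (rule U.M.finsum_cong')
      show "(\<lambda>x. a x \<odot>\<^bsub>U\<^esub> f x \<oplus>\<^bsub>U\<^esub> b x \<odot>\<^bsub>U\<^esub> f x) \<in> ?A \<rightarrow> carrier U"
        using cl[OF a A(2)] cl[OF b A(2)] by (auto simp: Pi_iff)
      show "(a \<oplus>\<^bsub>?F\<^esub> b) x \<odot>\<^bsub>U\<^esub> f x = a x \<odot>\<^bsub>U\<^esub> f x \<oplus>\<^bsub>U\<^esub> b x \<odot>\<^bsub>U\<^esub> f x" if "x \<in> ?A" for x
        unfolding e using that A assms(2) c a b by (intro U.smult_l_distr) (auto simp: Pi_iff)
    qed simp
    also have "\<dots> = (\<Oplus>\<^bsub>U\<^esub>x\<in>?A. a x \<odot>\<^bsub>U\<^esub> f x) \<oplus>\<^bsub>U\<^esub> (\<Oplus>\<^bsub>U\<^esub>x\<in>?A. b x \<odot>\<^bsub>U\<^esub> f x)"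
      using cl[OF a A(2)] cl[OF b A(2)] by (rule U.M.finsum_addf)
    also have "(\<Oplus>\<^bsub>U\<^esub>x\<in>?A. a x \<odot>\<^bsub>U\<^esub> f x) = free_ext K U f a"
      by (rule free_ext_superset[symmetric, OF assms a A]) auto
    also have "(\<Oplus>\<^bsub>U\<^esub>x\<in>?A. b x \<odot>\<^bsub>U\<^esub> f x) = free_ext K U f b"
      by (rule free_ext_superset[symmetric, OF assms b A]) auto
    finally show "free_ext K U f (a \<oplus>\<^bsub>?F\<^esub> b) = free_ext K U f a \<oplus>\<^bsub>U\<^esub> free_ext K U f b" .
  next
    fix k a assume k: "k \<in> carrier K" and a: "a \<in> carrier ?F"
    let ?A = "{x. a x \<noteq> \<zero>\<^bsub>K\<^esub>}"
    have A: "finite ?A" "?A \<subseteq> X" using s a by auto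
    have ka: "k \<odot>\<^bsub>?F\<^esub> a \<in> carrier ?F" using k a by simp
    have e: "(k \<odot>\<^bsub>?F\<^esub> a) x = k \<otimes>\<^bsub>K\<^esub> a x" for x by (simp add: free_module_def)
    have ska: "{x. (k \<odot>\<^bsub>?F\<^esub> a) x \<noteq> \<zero>\<^bsub>K\<^esub>} \<subseteq> ?A" using k by (auto simp: e)
    have "free_ext K U f (k \<odot>\<^bsub>?F\<^esub> a) = (\<Oplus>\<^bsub>U\<^esub>x\<in>?A. (k \<odot>\<^bsub>?F\<^esub> a) x \<odot>\<^bsub>U\<^esub> f x)"
      by (rule free_ext_superset[OF assms ka A ska])
    also have "\<dots> = (\<Oplus>\<^bsub>U\<^esub>x\<in>?A. k \<odot>\<^bsub>U\<^esub> (a x \<odot>\<^bsub>U\<^esub> f x))"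
    proof (rule U.M.finsum_cong')
      show "(\<lambda>x. k \<odot>\<^bsub>U\<^esub> (a x \<odot>\<^bsub>U\<^esub> f x)) \<in> ?A \<rightarrow> carrier U"
        using cl[OF a A(2)] k by (auto simp: Pi_iff)
      show "(k \<odot>\<^bsub>?F\<^esub> a) x \<odot>\<^bsub>U\<^esub> f x = k \<odot>\<^bsub>U\<^esub> (a x \<odot>\<^bsub>U\<^esub> f x)" if "x \<in> ?A" for x
        unfolding e using that A assms(2) c a k by (intro U.smult_assoc1) (auto simp: Pi_iff)
    qed simp
    also have "\<dots> = k \<odot>\<^bsub>U\<^esub> free_ext K U f a" unfolding free_ext_def
      by (rule U.finsum_smult_ldistr[symmetric, OF A(1) k cl[OF a A(2)]])
    finally show "free_ext K U f (k \<odot>\<^bsub>?F\<^esub> a) = k \<odot>\<^bsub>U\<^esub> free_ext K U f a" .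
  qed
qed

lemma free_ext_free_gen:
  assumes "module K U" "f x \<in> carrier U"
  shows "free_ext K U f (free_gen K x) = f x"
proof -
  interpret U: module K U by fact
  have "free_ext K U f (free_gen K x) = (\<Oplus>\<^bsub>U\<^esub>y\<in>{x}. free_gen K x y \<odot>\<^bsub>U\<^esub> f y)"
    by (rule free_ext_superset[where X = "{x}"])
      (use assms free_gen_closed[OF U.is_cring, of x "{x}"] in \<open>auto simp: free_gen_def\<close>)
  then show ?thesis using assms(2) by (simp add: free_gen_def)
qed

lemma free_module_decomp:
  assumes "cring K" "a \<in> carrier (free_module K X)"
  shows "free_ext K (free_module K X) (free_gen K) a = a"
proof -
  interpret cring K by fact
  let ?F = "free_module K X"
  interpret F: module K ?F by (rule module_free_module) fact
  have c: "a x \<in> carrier K" for x using assms(2) by (auto simp: free_module_def)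
  have *: "(\<Oplus>\<^bsub>?F\<^esub>x\<in>A. a x \<odot>\<^bsub>?F\<^esub> free_gen K x) = (\<lambda>y. if y \<in> A then a y else \<zero>\<^bsub>K\<^esub>)"
    if "finite A" "A \<subseteq> X" for A using that
  proof (induction A rule: finite_induct)
    case empty
    have "(\<Oplus>\<^bsub>?F\<^esub>x\<in>{}. a x \<odot>\<^bsub>?F\<^esub> free_gen K x) = \<zero>\<^bsub>?F\<^esub>" by (rule F.M.finsum_empty)
    then show ?case by (simp add: free_module_def)
  next
    case (insert x A)
    have "(\<Oplus>\<^bsub>?F\<^esub>y\<in>insert x A. a y \<odot>\<^bsub>?F\<^esub> free_gen K y) =
        a x \<odot>\<^bsub>?F\<^esub> free_gen K x \<oplus>\<^bsub>?F\<^esub> (\<Oplus>\<^bsub>?F\<^esub>y\<in>A. a y \<odot>\<^bsub>?F\<^esub> free_gen K y)"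
      by (rule F.M.finsum_insert)
        (use insert c free_gen_closed[OF assms(1), of _ X] in \<open>auto intro!: F.smult_closed\<close>)
    also have "\<dots> = a x \<odot>\<^bsub>?F\<^esub> free_gen K x \<oplus>\<^bsub>?F\<^esub> (\<lambda>y. if y \<in> A then a y else \<zero>\<^bsub>K\<^esub>)"
      using insert by simp
    also have "\<dots> = (\<lambda>y. if y \<in> insert x A then a y else \<zero>\<^bsub>K\<^esub>)"
      using insert c by (auto simp: free_module_def free_gen_def fun_eq_iff)
    finally show ?case .
  qed
  show ?thesis unfolding free_ext_def
    by (subst *) (use assms(2) in \<open>auto simp: free_module_def fun_eq_iff\<close>)
qed

lemma submodule_Inter:
  assumes "module K M" "\<S> \<noteq> {}" "\<And>S. S \<in> \<S> \<Longrightarrow> submodule S K M"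
  shows "submodule (\<Inter>\<S>) K M"
proof -
  interpret M: module K M by fact
  note E = M.submoduleE[OF assms(3)]
  have z: "\<zero>\<^bsub>M\<^esub> \<in> S" if "S \<in> \<S>" for S
    using subgroup.one_closed[OF submodule.axioms(1)[OF assms(3)[OF that]]] by simp
  show ?thesis
  proof (rule M.submoduleI)
    show "\<Inter>\<S> \<subseteq> carrier M" using E(1) assms(2) by blast
    show "\<zero>\<^bsub>M\<^esub> \<in> \<Inter>\<S>" using z by blast
    show "\<ominus>\<^bsub>M\<^esub> a \<in> \<Inter>\<S>" if "a \<in> \<Inter>\<S>" for a using that E(3) by blast
    show "a \<oplus>\<^bsub>M\<^esub> b \<in> \<Inter>\<S>" if "a \<in> \<Inter>\<S>" "b \<in> \<Inter>\<S>" for a b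
      using that E(5) by blast
    show "c \<odot>\<^bsub>M\<^esub> x \<in> \<Inter>\<S>" if "c \<in> carrier K" "x \<in> \<Inter>\<S>" for c x
      using that E(4) by blast
  qed
qed

lemma submodule_carrier:
  assumes "module K M" shows "submodule (carrier M) K M"
proof -
  interpret M: module K M by fact
  show ?thesis by (rule M.submoduleI) auto
qed

lemma submodule_span:
  assumes "module K M" "R \<subseteq> carrier M"
  shows "submodule (submodule_span K M R) K M" "R \<subseteq> submodule_span K M R"
    "submodule S K M \<Longrightarrow> R \<subseteq> S \<Longrightarrow> submodule_span K M R \<subseteq> S"
proof -
  show "submodule (submodule_span K M R) K M" unfolding submodule_span_def
    by (rule submodule_Inter[OF assms(1)]) (use submodule_carrier[OF assms(1)] assms(2) in auto)
qed (auto simp: submodule_span_def)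

lemma abelian_subgroup_submodule:
  assumes "module K M" "submodule N K M" shows "abelian_subgroup N M"
proof -
  interpret M: module K M by fact
  show ?thesis
    by (rule abelian_subgroupI3)
      (use assms(2) in \<open>auto simp: additive_subgroup_def submodule_def M.abelian_group_axioms\<close>)
qed

lemma quot_module_smult:
  assumes "module K M" "submodule N K M" "c \<in> carrier K" "x \<in> carrier M"
  shows "c \<odot>\<^bsub>quot_module M N\<^esub> (N +>\<^bsub>M\<^esub> x) = N +>\<^bsub>M\<^esub> (c \<odot>\<^bsub>M\<^esub> x)"
proof -
  interpret M: module K M by fact
  interpret N: abelian_subgroup N M by (rule abelian_subgroup_submodule) fact+
  have "N +>\<^bsub>M\<^esub> (c \<odot>\<^bsub>M\<^esub> y) = N +>\<^bsub>M\<^esub> (c \<odot>\<^bsub>M\<^esub> x)" if y: "y \<in> N +>\<^bsub>M\<^esub> x" for y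
  proof -
    obtain n where n: "n \<in> N" "y = n \<oplus>\<^bsub>M\<^esub> x"
      using y by (auto simp: a_r_coset_def')
    have "c \<odot>\<^bsub>M\<^esub> y = c \<odot>\<^bsub>M\<^esub> n \<oplus>\<^bsub>M\<^esub> c \<odot>\<^bsub>M\<^esub> x"
      using n assms(3,4) N.a_Hcarr by (simp add: M.smult_r_distr)
    then have "c \<odot>\<^bsub>M\<^esub> y \<in> N +>\<^bsub>M\<^esub> (c \<odot>\<^bsub>M\<^esub> x)"
      using submodule.smult_closed[OF assms(2,3) n(1)] by (auto simp: a_r_coset_def')
    then show ?thesis using assms(3,4) N.a_repr_independence' by auto
  qed
  moreover have "x \<in> N +>\<^bsub>M\<^esub> x" by (rule N.a_rcos_self) fact
  ultimately have "(\<Union>y\<in>N +>\<^bsub>M\<^esub> x. N +>\<^bsub>M\<^esub> (c \<odot>\<^bsub>M\<^esub> y)) = N +>\<^bsub>M\<^esub> (c \<odot>\<^bsub>M\<^esub> x)"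
    by blast
  then show ?thesis by (simp add: quot_module_def)
qed

lemma module_quot_module:
  assumes "module K M" "submodule N K M"
  shows "module K (quot_module M N)"
    and "linear_map K M (quot_module M N) (\<lambda>x. N +>\<^bsub>M\<^esub> x)"
proof -
  interpret M: module K M by fact
  interpret N: abelian_subgroup N M by (rule abelian_subgroup_submodule) fact+
  let ?Q = "quot_module M N"
  note sm = quot_module_smult[OF assms]
  have add: "(N +>\<^bsub>M\<^esub> x) \<oplus>\<^bsub>?Q\<^esub> (N +>\<^bsub>M\<^esub> y) = N +>\<^bsub>M\<^esub> (x \<oplus>\<^bsub>M\<^esub> y)"
    if "x \<in> carrier M" "y \<in> carrier M" for x y
    using N.a_rcos_sum[OF that] by (simp add: quot_module_def)
  have cl: "N +>\<^bsub>M\<^esub> x \<in> carrier ?Q" if "x \<in> carrier M" for x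
    using that by (auto simp: quot_module_def A_RCOSETS_def')
  have ex: "\<exists>x\<in>carrier M. X = N +>\<^bsub>M\<^esub> x" if "X \<in> carrier ?Q" for X
    using that by (auto simp: quot_module_def A_RCOSETS_def')
  have z: "\<zero>\<^bsub>?Q\<^esub> = N +>\<^bsub>M\<^esub> \<zero>\<^bsub>M\<^esub>"
    using M.a_coset_add_zero[OF N.a_subset] by (simp add: quot_module_def)
  show "linear_map K M ?Q (\<lambda>x. N +>\<^bsub>M\<^esub> x)"
    by (rule linear_mapI) (simp_all add: add cl sm)
  show "module K ?Q"
  proof (rule moduleI)
    show "abelian_group ?Q"
    proof (rule abelian_groupI)
      fix X assume "X \<in> carrier ?Q"
      then obtain x where x: "x \<in> carrier M" "X = N +>\<^bsub>M\<^esub> x" using ex by blast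
      show "\<zero>\<^bsub>?Q\<^esub> \<oplus>\<^bsub>?Q\<^esub> X = X" using x by (simp add: z add)
      show "\<exists>Y\<in>carrier ?Q. Y \<oplus>\<^bsub>?Q\<^esub> X = \<zero>\<^bsub>?Q\<^esub>"
        by (rule bexI[of _ "N +>\<^bsub>M\<^esub> (\<ominus>\<^bsub>M\<^esub> x)"]) (use x in \<open>simp_all add: add z cl M.M.l_neg\<close>)
      fix Y assume "Y \<in> carrier ?Q"
      then obtain y where y: "y \<in> carrier M" "Y = N +>\<^bsub>M\<^esub> y" using ex by blast
      show "X \<oplus>\<^bsub>?Q\<^esub> Y \<in> carrier ?Q" using x y by (simp add: add cl)
      show "X \<oplus>\<^bsub>?Q\<^esub> Y = Y \<oplus>\<^bsub>?Q\<^esub> X" using x y by (simp add: add M.M.a_comm)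
      fix Z assume "Z \<in> carrier ?Q"
      then obtain u where "u \<in> carrier M" "Z = N +>\<^bsub>M\<^esub> u" using ex by blast
      then show "X \<oplus>\<^bsub>?Q\<^esub> Y \<oplus>\<^bsub>?Q\<^esub> Z = X \<oplus>\<^bsub>?Q\<^esub> (Y \<oplus>\<^bsub>?Q\<^esub> Z)"
        using x y by (simp add: add M.M.a_assoc)
    qed (simp add: z cl)
    fix X assume "X \<in> carrier ?Q"
    then obtain x where x: "x \<in> carrier M" "X = N +>\<^bsub>M\<^esub> x" using ex by blast
    show "\<one>\<^bsub>K\<^esub> \<odot>\<^bsub>?Q\<^esub> X = X" using x by (simp add: sm)
    fix c assume c: "c \<in> carrier K"
    show "c \<odot>\<^bsub>?Q\<^esub> X \<in> carrier ?Q" using x c by (simp add: sm cl)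
    show "c \<odot>\<^bsub>?Q\<^esub> (X \<oplus>\<^bsub>?Q\<^esub> Y) = c \<odot>\<^bsub>?Q\<^esub> X \<oplus>\<^bsub>?Q\<^esub> c \<odot>\<^bsub>?Q\<^esub> Y" if Y: "Y \<in> carrier ?Q" for Y
    proof -
      obtain y where "y \<in> carrier M" "Y = N +>\<^bsub>M\<^esub> y" using ex Y by blast
      then show ?thesis using x c by (simp add: sm add M.smult_r_distr)
    qed
    fix d assume "d \<in> carrier K"
    then show "(c \<oplus>\<^bsub>K\<^esub> d) \<odot>\<^bsub>?Q\<^esub> X = c \<odot>\<^bsub>?Q\<^esub> X \<oplus>\<^bsub>?Q\<^esub> d \<odot>\<^bsub>?Q\<^esub> X"
      and "(c \<otimes>\<^bsub>K\<^esub> d) \<odot>\<^bsub>?Q\<^esub> X = c \<odot>\<^bsub>?Q\<^esub> (d \<odot>\<^bsub>?Q\<^esub> X)"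
      using x c by (simp_all add: sm add M.smult_l_distr M.smult_assoc1)
  qed (rule M.is_cring)
qed


section \<open>The tensor product\<close>

abbreviation tensor_free ::
  "('a, 'm) ring_scheme \<Rightarrow> ('a, 'v, 'p) module_scheme \<Rightarrow> ('a, 'w, 'q) module_scheme \<Rightarrow>
   ('a, 'v \<times> 'w \<Rightarrow> 'a) module" where
  "tensor_free K V W \<equiv> free_module K (carrier V \<times> carrier W)"

definition tensor_relators ::
  "('a, 'm) ring_scheme \<Rightarrow> ('a, 'v, 'p) module_scheme \<Rightarrow> ('a, 'w, 'q) module_scheme \<Rightarrow>
   ('v \<times> 'w \<Rightarrow> 'a) set" where
  "tensor_relators K V W =
     (let F = tensor_free K V W; e = (\<lambda>v w. free_gen K (v, w)) in
       {e (v \<oplus>\<^bsub>V\<^esub> v') w \<ominus>\<^bsub>F\<^esub> (e v w \<oplus>\<^bsub>F\<^esub> e v' w) | v v' w.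
          v \<in> carrier V \<and> v' \<in> carrier V \<and> w \<in> carrier W} \<union>
       {e v (w \<oplus>\<^bsub>W\<^esub> w') \<ominus>\<^bsub>F\<^esub> (e v w \<oplus>\<^bsub>F\<^esub> e v w') | v w w'.
          v \<in> carrier V \<and> w \<in> carrier W \<and> w' \<in> carrier W} \<union>
       {e (c \<odot>\<^bsub>V\<^esub> v) w \<ominus>\<^bsub>F\<^esub> (c \<odot>\<^bsub>F\<^esub> e v w) | c v w.
          c \<in> carrier K \<and> v \<in> carrier V \<and> w \<in> carrier W} \<union>
       {e v (c \<odot>\<^bsub>W\<^esub> w) \<ominus>\<^bsub>F\<^esub> (c \<odot>\<^bsub>F\<^esub> e v w) | c v w.
          c \<in> carrier K \<and> v \<in> carrier V \<and> w \<in> carrier W})"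

definition tensor_null ::
  "('a, 'm) ring_scheme \<Rightarrow> ('a, 'v, 'p) module_scheme \<Rightarrow> ('a, 'w, 'q) module_scheme \<Rightarrow>
   ('v \<times> 'w \<Rightarrow> 'a) set" where
  "tensor_null K V W = submodule_span K (tensor_free K V W) (tensor_relators K V W)"

definition tensor_prod ::
  "('a, 'm) ring_scheme \<Rightarrow> ('a, 'v, 'p) module_scheme \<Rightarrow> ('a, 'w, 'q) module_scheme \<Rightarrow>
   ('a, ('v \<times> 'w \<Rightarrow> 'a) set) module" where
  "tensor_prod K V W = quot_module (tensor_free K V W) (tensor_null K V W)"

definition tensor ::
  "('a, 'm) ring_scheme \<Rightarrow> ('a, 'v, 'p) module_scheme \<Rightarrow> ('a, 'w, 'q) module_scheme \<Rightarrow>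
   'v \<Rightarrow> 'w \<Rightarrow> ('v \<times> 'w \<Rightarrow> 'a) set" where
  "tensor K V W v w = tensor_null K V W +>\<^bsub>tensor_free K V W\<^esub> free_gen K (v, w)"

text \<open>
  The linear map \<open>V \<otimes> W \<rightarrow> U\<close> sending \<open>v \<otimes> w\<close> to \<open>f v w\<close>, for bilinear \<open>f\<close>: extend \<open>f\<close> linearly to
  the free module and evaluate at any representative of the coset. Independence of the
  representative and the universal property are shown in \<open>linear_map_tensor_lift\<close>,
  \<open>tensor_lift_tensor\<close> and \<open>tensor_prod_ext\<close> below.
\<close>

definition tensor_lift ::
  "('a, 'm) ring_scheme \<Rightarrow> ('a, 'u, 'r) module_scheme \<Rightarrow> ('v \<Rightarrow> 'w \<Rightarrow> 'u) \<Rightarrow> ('v \<times> 'w \<Rightarrow> 'a) set \<Rightarrow> 'u"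
  where
  "tensor_lift K U f X = free_ext K U (\<lambda>(v, w). f v w) (SOME x. x \<in> X)"

lemma tensor_relators_closed:
  assumes "module K V" "module K W"
  shows "tensor_relators K V W \<subseteq> carrier (tensor_free K V W)"
proof -
  interpret V: module K V by fact
  interpret W: module K W by fact
  interpret F: module K "tensor_free K V W" by (rule module_free_module) (rule V.is_cring)
  have "free_gen K (v, w) \<in> carrier (tensor_free K V W)" if "v \<in> carrier V" "w \<in> carrier W" for v w
    by (rule free_gen_closed[OF V.is_cring]) (use that in simp)
  then show ?thesis by (auto simp: tensor_relators_def Let_def intro!: F.M.minus_closed)
qed

lemma tensor_null:
  assumes "module K V" "module K W"
  shows "submodule (tensor_null K V W) K (tensor_free K V W)"
    and "tensor_relators K V W \<subseteq> tensor_null K V W"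
proof -
  interpret V: module K V by fact
  have F: "module K (tensor_free K V W)" by (rule module_free_module) (rule V.is_cring)
  show "submodule (tensor_null K V W) K (tensor_free K V W)"
    and "tensor_relators K V W \<subseteq> tensor_null K V W"
    unfolding tensor_null_def by (rule submodule_span[OF F tensor_relators_closed[OF assms]])+
qed

lemma module_tensor_prod:
  assumes "module K V" "module K W"
  shows "module K (tensor_prod K V W)"
  unfolding tensor_prod_def using assms
  by (intro module_quot_module(1) module_free_module tensor_null(1)) (auto simp: module_def)

lemma linear_map_tensor_coset:
  assumes "module K V" "module K W"
  shows "linear_map K (tensor_free K V W) (tensor_prod K V W)
    (\<lambda>x. tensor_null K V W +>\<^bsub>tensor_free K V W\<^esub> x)"
  unfolding tensor_prod_def using assms
  by (intro module_quot_module(2) module_free_module tensor_null(1)) (auto simp: module_def)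

lemma bilinear_map_tensor:
  assumes "module K V" "module K W"
  shows "bilinear_map K V W (tensor_prod K V W) (tensor K V W)"
proof -
  interpret V: module K V by fact
  interpret W: module K W by fact
  let ?F = "tensor_free K V W" and ?N = "tensor_null K V W" and ?T = "tensor_prod K V W"
  have F: "module K ?F" by (rule module_free_module) (rule V.is_cring)
  interpret F: module K ?F by (rule F)
  interpret N: abelian_subgroup ?N ?F
    by (rule abelian_subgroup_submodule[OF F tensor_null(1)[OF assms]])
  note L = linear_mapD[OF linear_map_tensor_coset[OF assms]]
  have g: "free_gen K (v, w) \<in> carrier ?F" if "v \<in> carrier V" "w \<in> carrier W" for v w
    by (rule free_gen_closed[OF V.is_cring]) (use that in simp)
  have eq: "?N +>\<^bsub>?F\<^esub> x = ?N +>\<^bsub>?F\<^esub> y"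
    if "x \<in> carrier ?F" "y \<in> carrier ?F" "x \<ominus>\<^bsub>?F\<^esub> y \<in> tensor_relators K V W" for x y
  proof -
    have "x \<in> ?N +>\<^bsub>?F\<^esub> y"
      using N.a_rcos_module_minus[OF _ that(2,1)] that tensor_null(2)[OF assms] N.a_rcos_module_rev
      by (auto simp: a_minus_def)
    then show ?thesis using that N.a_repr_independence' by auto
  qed
  show ?thesis unfolding bilinear_map_def tensor_def
  proof (intro conjI ballI linear_mapI)
    fix w v v' assume "w \<in> carrier W" "v \<in> carrier V" "v' \<in> carrier V"
    then show "?N +>\<^bsub>?F\<^esub> free_gen K (v \<oplus>\<^bsub>V\<^esub> v', w) =
        (?N +>\<^bsub>?F\<^esub> free_gen K (v, w)) \<oplus>\<^bsub>?T\<^esub> (?N +>\<^bsub>?F\<^esub> free_gen K (v', w))"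
      by (subst L(2)[symmetric], simp_all add: g)
        (intro eq, auto simp: g tensor_relators_def Let_def)
  next
    fix v w w' assume "v \<in> carrier V" "w \<in> carrier W" "w' \<in> carrier W"
    then show "?N +>\<^bsub>?F\<^esub> free_gen K (v, w \<oplus>\<^bsub>W\<^esub> w') =
        (?N +>\<^bsub>?F\<^esub> free_gen K (v, w)) \<oplus>\<^bsub>?T\<^esub> (?N +>\<^bsub>?F\<^esub> free_gen K (v, w'))"
      by (subst L(2)[symmetric], simp_all add: g)
        (intro eq, auto simp: g tensor_relators_def Let_def)
  next
    fix w c v assume "w \<in> carrier W" "c \<in> carrier K" "v \<in> carrier V"
    then show "?N +>\<^bsub>?F\<^esub> free_gen K (c \<odot>\<^bsub>V\<^esub> v, w) = c \<odot>\<^bsub>?T\<^esub> (?N +>\<^bsub>?F\<^esub> free_gen K (v, w))"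
      by (subst L(3)[symmetric], simp_all add: g)
        (intro eq, auto simp: g tensor_relators_def Let_def)
  next
    fix v c w assume "v \<in> carrier V" "c \<in> carrier K" "w \<in> carrier W"
    then show "?N +>\<^bsub>?F\<^esub> free_gen K (v, c \<odot>\<^bsub>W\<^esub> w) = c \<odot>\<^bsub>?T\<^esub> (?N +>\<^bsub>?F\<^esub> free_gen K (v, w))"
      by (subst L(3)[symmetric], simp_all add: g)
        (intro eq, auto simp: g tensor_relators_def Let_def)
  qed (auto intro: L(1) g)
qed

lemma free_ext_bilinear:
  assumes "module K V" "module K W" "module K U" "bilinear_map K V W U f"
  shows "linear_map K (tensor_free K V W) U (free_ext K U (\<lambda>(v, w). f v w))"
    and "v \<in> carrier V \<Longrightarrow> w \<in> carrier W \<Longrightarrow>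
      free_ext K U (\<lambda>(v, w). f v w) (free_gen K (v, w)) = f v w"
    and "x \<in> tensor_null K V W \<Longrightarrow> free_ext K U (\<lambda>(v, w). f v w) x = \<zero>\<^bsub>U\<^esub>"
proof -
  interpret V: module K V by fact
  interpret W: module K W by fact
  interpret U: module K U by fact
  let ?F = "tensor_free K V W" and ?e = "free_ext K U (\<lambda>(v, w). f v w)"
  have F: "module K ?F" by (rule module_free_module) (rule V.is_cring)
  interpret F: module K ?F by (rule F)
  have l: "linear_map K V U (\<lambda>v. f v w)" if "w \<in> carrier W" for w
    using assms(4) that by (auto simp: bilinear_map_def)
  have r: "linear_map K W U (f v)" if "v \<in> carrier V" for v
    using assms(4) that by (auto simp: bilinear_map_def)
  have cl: "f v w \<in> carrier U" if "v \<in> carrier V" "w \<in> carrier W" for v w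
    using linear_mapD(1)[OF l] that by blast
  show L: "linear_map K ?F U ?e"
    by (rule linear_map_free_ext) (use cl assms(3) in auto)
  have G: "?e (free_gen K (v, w)) = f v w" if "v \<in> carrier V" "w \<in> carrier W" for v w
    using free_ext_free_gen[OF assms(3), of "\<lambda>(v, w). f v w" "(v, w)"] cl that by simp
  then show "?e (free_gen K (v, w)) = f v w" if "v \<in> carrier V" "w \<in> carrier W" using that by blast
  have g: "free_gen K (v, w) \<in> carrier ?F" if "v \<in> carrier V" "w \<in> carrier W" for v w
    by (rule free_gen_closed[OF V.is_cring]) (use that in simp)
  let ?S = "{x \<in> carrier ?F. ?e x = \<zero>\<^bsub>U\<^esub>}"
  note D = linear_mapD[OF L] linear_map_zero[OF F assms(3) L] linear_map_minus[OF F assms(3) L]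
  have "submodule ?S K ?F"
  proof (rule F.submoduleI)
    fix a assume a: "a \<in> ?S"
    then have "?e (\<zero>\<^bsub>?F\<^esub> \<ominus>\<^bsub>?F\<^esub> a) = \<zero>\<^bsub>U\<^esub>" by (subst D(5)) (auto simp: D(4) a_minus_def)
    then show "\<ominus>\<^bsub>?F\<^esub> a \<in> ?S" using a by (simp add: a_minus_def)
  qed (auto simp: D)
  moreover have "tensor_relators K V W \<subseteq> ?S"
  proof
    fix x assume x: "x \<in> tensor_relators K V W"
    then have "?e x = \<zero>\<^bsub>U\<^esub>"
      unfolding tensor_relators_def Let_def
      by (elim UnE CollectE exE conjE; hypsubst)
        (simp_all add: D g G cl linear_mapD[OF l] linear_mapD[OF r] U.M.r_neg a_minus_def[of U])
    then show "x \<in> ?S" using x tensor_relators_closed[OF assms(1,2)] by blast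
  qed
  ultimately have "tensor_null K V W \<subseteq> ?S" unfolding tensor_null_def
    by (rule submodule_span(3)[OF F tensor_relators_closed[OF assms(1,2)]])
  then show "x \<in> tensor_null K V W \<Longrightarrow> ?e x = \<zero>\<^bsub>U\<^esub>" by blast
qed

lemma tensor_lift_coset:
  assumes "module K V" "module K W" "module K U" "bilinear_map K V W U f"
    and x: "x \<in> carrier (tensor_free K V W)"
  shows "tensor_lift K U f (tensor_null K V W +>\<^bsub>tensor_free K V W\<^esub> x) =
    free_ext K U (\<lambda>(v, w). f v w) x"
proof -
  interpret V: module K V by fact
  interpret U: module K U by fact
  let ?F = "tensor_free K V W" and ?N = "tensor_null K V W"
  have F: "module K ?F" by (rule module_free_module) (rule V.is_cring)
  interpret F: module K ?F by (rule F)
  interpret N: abelian_subgroup ?N ?F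
    by (rule abelian_subgroup_submodule[OF F tensor_null(1)[OF assms(1,2)]])
  note E = free_ext_bilinear[OF assms(1-4)]
  have "(SOME y. y \<in> ?N +>\<^bsub>?F\<^esub> x) \<in> ?N +>\<^bsub>?F\<^esub> x"
    by (rule someI[of "\<lambda>y. y \<in> ?N +>\<^bsub>?F\<^esub> x", OF N.a_rcos_self[OF x]])
  then obtain n where n: "n \<in> ?N" "(SOME y. y \<in> ?N +>\<^bsub>?F\<^esub> x) = n \<oplus>\<^bsub>?F\<^esub> x"
    by (auto simp: a_r_coset_def')
  show ?thesis unfolding tensor_lift_def n(2)
    using n(1) x N.a_Hcarr linear_mapD[OF E(1)] E(3) by simp
qed

lemma tensor_prod_cases:
  assumes "X \<in> carrier (tensor_prod K V W)"
  obtains x where "x \<in> carrier (tensor_free K V W)"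
    "X = tensor_null K V W +>\<^bsub>tensor_free K V W\<^esub> x"
  using assms by (auto simp: tensor_prod_def quot_module_def A_RCOSETS_def')

lemma linear_map_tensor_lift:
  assumes "module K V" "module K W" "module K U" "bilinear_map K V W U f"
  shows "linear_map K (tensor_prod K V W) U (tensor_lift K U f)"
proof -
  interpret V: module K V by fact
  interpret F: module K "tensor_free K V W" by (rule module_free_module) (rule V.is_cring)
  note E = linear_mapD[OF free_ext_bilinear(1)[OF assms]]
  note C = linear_mapD[OF linear_map_tensor_coset[OF assms(1,2)]]
  note T = tensor_lift_coset[OF assms]
  show ?thesis
    by (rule linear_mapI; (elim tensor_prod_cases)?; hypsubst)
      (simp_all add: T E C(2,3)[symmetric])
qed

lemma tensor_lift_tensor:
  assumes "module K V" "module K W" "module K U" "bilinear_map K V W U f"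
    and "v \<in> carrier V" "w \<in> carrier W"
  shows "tensor_lift K U f (tensor K V W v w) = f v w"
proof -
  interpret V: module K V by fact
  have "free_gen K (v, w) \<in> carrier (tensor_free K V W)"
    by (rule free_gen_closed[OF V.is_cring]) (use assms in simp)
  then show ?thesis unfolding tensor_def
    by (simp add: tensor_lift_coset[OF assms(1-4)] free_ext_bilinear(2)[OF assms])
qed

lemma tensor_prod_ext:
  assumes "module K V" "module K W" "module K U"
    and "linear_map K (tensor_prod K V W) U f" "linear_map K (tensor_prod K V W) U g"
    and eq: "\<And>v w. v \<in> carrier V \<Longrightarrow> w \<in> carrier W \<Longrightarrow> f (tensor K V W v w) = g (tensor K V W v w)"
    and X: "X \<in> carrier (tensor_prod K V W)"
  shows "f X = g X"
proof -
  interpret V: module K V by fact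
  interpret U: module K U by fact
  let ?F = "tensor_free K V W" and ?N = "tensor_null K V W" and ?T = "tensor_prod K V W"
  interpret F: module K ?F by (rule module_free_module) (rule V.is_cring)
  interpret T: module K ?T by (rule module_tensor_prod) fact+
  note L = linear_mapD[OF linear_map_tensor_coset[OF assms(1,2)]]
  have gen: "free_gen K x \<in> carrier ?F" if "x \<in> carrier V \<times> carrier W" for x
    by (rule free_gen_closed[OF V.is_cring that])
  have *: "f (?N +>\<^bsub>?F\<^esub> (\<Oplus>\<^bsub>?F\<^esub>x\<in>A. a x \<odot>\<^bsub>?F\<^esub> free_gen K x)) =
      g (?N +>\<^bsub>?F\<^esub> (\<Oplus>\<^bsub>?F\<^esub>x\<in>A. a x \<odot>\<^bsub>?F\<^esub> free_gen K x))"
    if "finite A" "A \<subseteq> carrier V \<times> carrier W" "\<And>x. a x \<in> carrier K" for a A using that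
  proof (induction A rule: finite_induct)
    case empty
    then show ?case
      using linear_map_zero[OF module_tensor_prod[OF assms(1,2)] assms(3) assms(4)]
        linear_map_zero[OF module_tensor_prod[OF assms(1,2)] assms(3) assms(5)]
        linear_map_zero[OF F.module_axioms module_tensor_prod[OF assms(1,2)]
          linear_map_tensor_coset[OF assms(1,2)]]
      by simp
  next
    case (insert x A)
    have A: "(\<lambda>y. a y \<odot>\<^bsub>?F\<^esub> free_gen K y) \<in> A \<rightarrow> carrier ?F" "free_gen K x \<in> carrier ?F"
      using insert gen by auto
    let ?y = "\<Oplus>\<^bsub>?F\<^esub>y\<in>A. a y \<odot>\<^bsub>?F\<^esub> free_gen K y"
    have y: "?y \<in> carrier ?F" by (rule F.M.finsum_closed[OF A(1)])
    have ax: "a x \<in> carrier K" using insert by blast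
    have sum: "(\<Oplus>\<^bsub>?F\<^esub>y\<in>insert x A. a y \<odot>\<^bsub>?F\<^esub> free_gen K y) =
        a x \<odot>\<^bsub>?F\<^esub> free_gen K x \<oplus>\<^bsub>?F\<^esub> ?y"
      by (rule F.M.finsum_insert) (use insert A in auto)
    have H: "h (a x \<odot>\<^bsub>?T\<^esub> (?N +>\<^bsub>?F\<^esub> free_gen K x) \<oplus>\<^bsub>?T\<^esub> (?N +>\<^bsub>?F\<^esub> ?y)) =
        a x \<odot>\<^bsub>U\<^esub> h (?N +>\<^bsub>?F\<^esub> free_gen K x) \<oplus>\<^bsub>U\<^esub> h (?N +>\<^bsub>?F\<^esub> ?y)"
      if h: "linear_map K ?T U h" for h
      using linear_mapD[OF h] T.smult_closed[OF ax] L(1)[OF A(2)] L(1)[OF y] ax by simp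
    have "?N +>\<^bsub>?F\<^esub> (a x \<odot>\<^bsub>?F\<^esub> free_gen K x \<oplus>\<^bsub>?F\<^esub> ?y) =
        a x \<odot>\<^bsub>?T\<^esub> (?N +>\<^bsub>?F\<^esub> free_gen K x) \<oplus>\<^bsub>?T\<^esub> (?N +>\<^bsub>?F\<^esub> ?y)"
      using L(2)[OF F.smult_closed[OF ax A(2)] y] L(3)[OF ax A(2)] by simp
    moreover have "f (?N +>\<^bsub>?F\<^esub> free_gen K x) = g (?N +>\<^bsub>?F\<^esub> free_gen K x)"
      using insert eq by (cases x) (auto simp: tensor_def)
    moreover have "f (?N +>\<^bsub>?F\<^esub> ?y) = g (?N +>\<^bsub>?F\<^esub> ?y)"
      using insert by blast
    ultimately show ?case unfolding sum using H[OF assms(4)] H[OF assms(5)] by simp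
  qed
  obtain x where x: "x \<in> carrier ?F" "X = ?N +>\<^bsub>?F\<^esub> x" using X by (rule tensor_prod_cases)
  have "finite {y. x y \<noteq> \<zero>\<^bsub>K\<^esub>}" "{y. x y \<noteq> \<zero>\<^bsub>K\<^esub>} \<subseteq> carrier V \<times> carrier W" "\<And>y. x y \<in> carrier K"
    using x(1) by (auto simp: free_module_def)
  from *[OF this] have "f (?N +>\<^bsub>?F\<^esub> free_ext K ?F (free_gen K) x) =
      g (?N +>\<^bsub>?F\<^esub> free_ext K ?F (free_gen K) x)"
    by (simp add: free_ext_def)
  then show ?thesis using free_module_decomp[OF V.is_cring x(1)] x(2) by simp
qed

definition tensor_map ::
  "('a, 'm) ring_scheme \<Rightarrow> ('a, 'v, 'p) module_scheme \<Rightarrow> ('a, 'w, 'q) module_scheme \<Rightarrow>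
   ('x \<Rightarrow> 'v) \<Rightarrow> ('y \<Rightarrow> 'w) \<Rightarrow> ('x \<times> 'y \<Rightarrow> 'a) set \<Rightarrow> ('v \<times> 'w \<Rightarrow> 'a) set" where
  "tensor_map K V W f g = tensor_lift K (tensor_prod K V W) (\<lambda>x y. tensor K V W (f x) (g y))"

text \<open>
  The canonical isomorphism \<open>(U \<otimes> V) \<otimes> W \<rightarrow> U \<otimes> (V \<otimes> W)\<close>, \<open>(u \<otimes> v) \<otimes> w \<mapsto> u \<otimes> (v \<otimes> w)\<close>, and its
  inverse. They make explicit the usual identification of both sides with \<open>U \<otimes> V \<otimes> W\<close>.
\<close>

definition tensor_assoc where
  "tensor_assoc K U V W =
     (let VW = tensor_prod K V W; UVW = tensor_prod K U VW in
       tensor_lift K UVW (\<lambda>x w. tensor_lift K UVW (\<lambda>u v. tensor K U VW u (tensor K V W v w)) x))"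

definition tensor_assoc_inv where
  "tensor_assoc_inv K U V W =
     (let UV = tensor_prod K U V; UVW = tensor_prod K UV W in
       tensor_lift K UVW (\<lambda>u y. tensor_lift K UVW (\<lambda>v w. tensor K UV W (tensor K U V u v) w) y))"


section \<open>Hom-coalgebras and the Hom-Yang-Baxter equation\<close>

text \<open>
  The four axioms read \<open>\<Delta> \<circ> \<alpha> = (\<alpha> \<otimes> \<alpha>) \<circ> \<Delta>\<close>, \<open>\<epsilon> \<circ> \<alpha> = \<epsilon>\<close>,
  \<open>(\<alpha> \<otimes> \<Delta>) \<circ> \<Delta> = (\<Delta> \<otimes> \<alpha>) \<circ> \<Delta>\<close> in \<open>C \<otimes> (C \<otimes> C)\<close>, and
  \<open>\<epsilon>(c\<^sub>1) c\<^sub>2 = c\<^sub>1 \<epsilon>(c\<^sub>2) = \<alpha>(c)\<close>.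
\<close>

locale hom_coalgebra = field K + module K C
  for K :: "('a, 'm) ring_scheme" (structure) and C :: "('a, 'c, 'n) module_scheme" (structure) +
  fixes \<Delta> :: "'c \<Rightarrow> ('c \<times> 'c \<Rightarrow> 'a) set" and \<epsilon> :: "'c \<Rightarrow> 'a" and \<alpha> :: "'c \<Rightarrow> 'c"
  assumes linear_comult: "linear_map K C (tensor_prod K C C) \<Delta>"
    and linear_counit: "linear_map K C (self_module K) \<epsilon>"
    and linear_twist: "linear_map K C C \<alpha>"
    and comult_twist: "c \<in> carrier C \<Longrightarrow> \<Delta> (\<alpha> c) = tensor_map K C C \<alpha> \<alpha> (\<Delta> c)"
    and counit_twist: "c \<in> carrier C \<Longrightarrow> \<epsilon> (\<alpha> c) = \<epsilon> c"
    and hom_coassoc: "c \<in> carrier C \<Longrightarrow>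
      tensor_map K C (tensor_prod K C C) \<alpha> \<Delta> (\<Delta> c) =
      tensor_assoc K C C C (tensor_map K (tensor_prod K C C) C \<Delta> \<alpha> (\<Delta> c))"
    and counit_left: "c \<in> carrier C \<Longrightarrow> tensor_lift K C (\<lambda>a b. \<epsilon> a \<odot>\<^bsub>C\<^esub> b) (\<Delta> c) = \<alpha> c"
    and counit_right: "c \<in> carrier C \<Longrightarrow> tensor_lift K C (\<lambda>a b. \<epsilon> b \<odot>\<^bsub>C\<^esub> a) (\<Delta> c) = \<alpha> c"

text \<open>
  The maps \<open>\<alpha> \<otimes> B\<close> and \<open>B \<otimes> \<alpha>\<close> of \<open>V \<otimes> V \<otimes> V\<close>, both taken on \<open>V \<otimes> (V \<otimes> V)\<close>; \<open>B \<otimes> \<alpha>\<close> is conjugated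
  with the associativity isomorphism.
\<close>

definition hybe_right where
  "hybe_right K V \<alpha> B = tensor_map K V (tensor_prod K V V) \<alpha> B"

definition hybe_left where
  "hybe_left K V \<alpha> B =
     tensor_assoc K V V V \<circ> tensor_map K (tensor_prod K V V) V B \<alpha> \<circ> tensor_assoc_inv K V V V"

definition hybe_solution ::
  "('a, 'm) ring_scheme \<Rightarrow> ('a, 'v, 'p) module_scheme \<Rightarrow> ('v \<Rightarrow> 'v) \<Rightarrow>
   (('v \<times> 'v \<Rightarrow> 'a) set \<Rightarrow> ('v \<times> 'v \<Rightarrow> 'a) set) \<Rightarrow> bool" where
  "hybe_solution K V \<alpha> B \<longleftrightarrow>
     linear_map K V V \<alpha> \<and>
     linear_map K (tensor_prod K V V) (tensor_prod K V V) B \<and>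
     (\<forall>x\<in>carrier (tensor_prod K V V).
        tensor_map K V V \<alpha> \<alpha> (B x) = B (tensor_map K V V \<alpha> \<alpha> x)) \<and>
     (\<forall>x\<in>carrier (tensor_prod K V (tensor_prod K V V)).
        (hybe_right K V \<alpha> B \<circ> hybe_left K V \<alpha> B \<circ> hybe_right K V \<alpha> B) x =
        (hybe_left K V \<alpha> B \<circ> hybe_right K V \<alpha> B \<circ> hybe_left K V \<alpha> B) x)"

end

theory Submission
  imports Defs
begin

text \<open>
  Up to a multiple of a twist, \<open>B\<close> factors through contractions with the counit. Write \<open>A\<close> for \<open>\<alpha> \<otimes> \<alpha>\<close> and let
  \<open>contract_left\<close>, \<open>contract_right\<close> be the maps \<open>C \<otimes> C \<rightarrow> C\<close> that apply \<open>\<epsilon>\<close> to the left or the right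
  factor. Then \<open>B = \<mu> E + \<nu> (E' - A)\<close> with \<open>E = \<Delta> \<circ> contract_left\<close> and \<open>E' = \<Delta> \<circ> contract_right\<close>.
  The counit axioms say that either contraction undoes \<open>\<Delta>\<close> up to \<open>\<alpha>\<close>, and therefore
  \<open>E E = E' E = A E\<close> and \<open>E E' = E' E' = A E'\<close>, where \<open>A\<close> commutes with everything. The
  formula for the inverse is a computation with these four products and \<open>A\<^sup>2 = 1\<close>
  (\<open>braiding_composite_id\<close>).

  On \<open>C \<otimes> C \<otimes> C\<close> the same idea separates the two kinds of operations in \<open>\<alpha> \<otimes> B\<close> and \<open>B \<otimes> \<alpha>\<close>.
  There are three maps \<open>face1\<close>, \<open>face2\<close>, \<open>face3\<close> down to \<open>C \<otimes> C\<close>, which apply \<open>\<epsilon>\<close> to one tensor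
  factor, and two maps \<open>split_right = \<alpha> \<otimes> \<Delta>\<close>, \<open>split_left = \<Delta> \<otimes> \<alpha>\<close> up from it, and
  \<open>\<alpha> \<otimes> B = \<mu> P + \<nu> (Q - A)\<close> and \<open>B \<otimes> \<alpha> = \<mu> P' + \<nu> (Q' - A)\<close> hold, now with the triple twist \<open>A\<close>, for
  \<open>P = split_right \<circ> face2\<close>, \<open>Q = split_right \<circ> face3\<close>, \<open>P' = split_left \<circ> face1\<close>,
  \<open>Q' = split_left \<circ> face2\<close>.
  Going up and then down gives the twist, or \<open>E\<close> or \<open>E'\<close> when the contracted factor is the one that
  was not split (\<open>face_split\<close>). Two contractions in a row leave one factor of \<open>C\<close>, whatever their
  order (\<open>contract_face\<close>). Hom-coassociativity says that the two ways up agree on the image of \<open>\<Delta>\<close>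
  (\<open>split_comult\<close>). These facts reduce ten of the sixteen quadratic words in \<open>P\<close>, \<open>Q\<close>, \<open>P'\<close>, \<open>Q'\<close> to \<open>A\<close> times a
  single letter, and they give \<open>Q P' = P' Q\<close> and the two cubic relations \<open>P P' P = P' P P'\<close> and \<open>Q Q' Q = Q' Q Q'\<close>. From these word relations alone the
  Hom-Yang-Baxter equation follows, one monomial in \<open>\<mu>\<close> and \<open>\<nu>\<close> at a time
  (\<open>braid_relation_of_words\<close>). No Sweedler sum is ever written out: the identities of linear maps
  behind the word relations are checked on pure tensors.
\<close>

section \<open>Linear maps and tensor products\<close>

lemma linear_map_comp:
  assumes "linear_map K V W f" "linear_map K W U g"
  shows "linear_map K V U (\<lambda>x. g (f x))"
  by (rule linear_mapI) (simp_all add: linear_mapD[OF assms(1)] linear_mapD[OF assms(2)])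

lemma linear_map_id: "linear_map K V V (\<lambda>x. x)"
  by (auto simp: linear_map_def)

lemma linear_map_cong:
  assumes "module K V" "linear_map K V W g" "\<And>v. v \<in> carrier V \<Longrightarrow> f v = g v"
  shows "linear_map K V W f"
proof -
  interpret V: module K V by fact
  show ?thesis using assms(2) unfolding linear_map_def by (simp add: assms(3) Pi_iff)
qed

lemma smult_left_commute:
  assumes "module K M" "a \<in> carrier K" "c \<in> carrier K" "x \<in> carrier M"
  shows "a \<odot>\<^bsub>M\<^esub> (c \<odot>\<^bsub>M\<^esub> x) = c \<odot>\<^bsub>M\<^esub> (a \<odot>\<^bsub>M\<^esub> x)"
proof -
  interpret M: module K M by fact
  show ?thesis using assms(2-4) by (simp add: M.smult_assoc1[symmetric] M.R.m_comm)
qed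

lemma linear_map_lincomb:
  assumes "module K V" "module K W" "linear_map K V W f" "linear_map K V W g" "linear_map K V W h"
    and "r \<in> carrier K" "s \<in> carrier K" "t \<in> carrier K"
  shows "linear_map K V W (\<lambda>x. r \<odot>\<^bsub>W\<^esub> f x \<oplus>\<^bsub>W\<^esub> s \<odot>\<^bsub>W\<^esub> g x \<ominus>\<^bsub>W\<^esub> t \<odot>\<^bsub>W\<^esub> h x)"
proof -
  interpret V: module K V by fact
  interpret W: module K W by fact
  note D = linear_mapD[OF assms(3)] linear_mapD[OF assms(4)] linear_mapD[OF assms(5)]
  show ?thesis
  proof (rule linear_mapI)
    fix x assume x: "x \<in> carrier V"
    show "r \<odot>\<^bsub>W\<^esub> f x \<oplus>\<^bsub>W\<^esub> s \<odot>\<^bsub>W\<^esub> g x \<ominus>\<^bsub>W\<^esub> t \<odot>\<^bsub>W\<^esub> h x \<in> carrier W"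
      using x assms(6-8) by (simp add: D)
    fix y assume y: "y \<in> carrier V"
    show "r \<odot>\<^bsub>W\<^esub> f (x \<oplus>\<^bsub>V\<^esub> y) \<oplus>\<^bsub>W\<^esub> s \<odot>\<^bsub>W\<^esub> g (x \<oplus>\<^bsub>V\<^esub> y) \<ominus>\<^bsub>W\<^esub> t \<odot>\<^bsub>W\<^esub> h (x \<oplus>\<^bsub>V\<^esub> y) =
      (r \<odot>\<^bsub>W\<^esub> f x \<oplus>\<^bsub>W\<^esub> s \<odot>\<^bsub>W\<^esub> g x \<ominus>\<^bsub>W\<^esub> t \<odot>\<^bsub>W\<^esub> h x) \<oplus>\<^bsub>W\<^esub>
      (r \<odot>\<^bsub>W\<^esub> f y \<oplus>\<^bsub>W\<^esub> s \<odot>\<^bsub>W\<^esub> g y \<ominus>\<^bsub>W\<^esub> t \<odot>\<^bsub>W\<^esub> h y)"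
      using x y assms(6-8) by (simp add: D W.smult_r_distr a_minus_def W.M.minus_add W.M.a_ac)
  next
    fix c x assume "c \<in> carrier K" "x \<in> carrier V"
    then show "r \<odot>\<^bsub>W\<^esub> f (c \<odot>\<^bsub>V\<^esub> x) \<oplus>\<^bsub>W\<^esub> s \<odot>\<^bsub>W\<^esub> g (c \<odot>\<^bsub>V\<^esub> x) \<ominus>\<^bsub>W\<^esub> t \<odot>\<^bsub>W\<^esub> h (c \<odot>\<^bsub>V\<^esub> x) =
      c \<odot>\<^bsub>W\<^esub> (r \<odot>\<^bsub>W\<^esub> f x \<oplus>\<^bsub>W\<^esub> s \<odot>\<^bsub>W\<^esub> g x \<ominus>\<^bsub>W\<^esub> t \<odot>\<^bsub>W\<^esub> h x)"
      using assms(6-8)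
      by (simp add: D W.smult_r_distr a_minus_def W.smult_r_minus[symmetric] smult_left_commute[OF assms(2)])
  qed
qed

lemma bilinear_map_flip:
  "bilinear_map K V W U f \<Longrightarrow> bilinear_map K W V U (\<lambda>w v. f v w)"
  by (auto simp: bilinear_map_def)

lemma bilinear_map_comp:
  assumes "bilinear_map K V W U f" "linear_map K V' V p" "linear_map K W' W q" "linear_map K U Z h"
  shows "bilinear_map K V' W' Z (\<lambda>x y. h (f (p x) (q y)))"
  using assms unfolding bilinear_map_def linear_map_def by (simp add: Pi_iff)

lemma bilinear_map_cong:
  assumes "module K V" "module K W" "bilinear_map K V W U g"
    and "\<And>v w. v \<in> carrier V \<Longrightarrow> w \<in> carrier W \<Longrightarrow> f v w = g v w"
  shows "bilinear_map K V W U f"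
proof -
  interpret V: module K V by fact
  interpret W: module K W by fact
  show ?thesis using assms(3) unfolding bilinear_map_def linear_map_def by (simp add: assms(4) Pi_iff)
qed

lemma bilinear_map_functional_smult:
  assumes "module K V" "module K W" "linear_map K V (self_module K) \<phi>"
  shows "bilinear_map K V W W (\<lambda>v w. \<phi> v \<odot>\<^bsub>W\<^esub> w)"
proof -
  interpret V: module K V by fact
  interpret W: module K W by fact
  note D = linear_mapD[OF assms(3), unfolded self_module_def, simplified]
  show ?thesis unfolding bilinear_map_def
    by (intro conjI ballI linear_mapI)
      (simp_all add: D W.smult_l_distr W.smult_r_distr W.smult_assoc1 smult_left_commute[OF assms(2)])
qed

text \<open>
  A map given by a formula on pairs is often visibly the restriction of a linear map \<open>G\<close> to pure
  tensors. Bilinearity then comes for free, and the lift may be replaced by \<open>G\<close>.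
\<close>

lemma tensor_lift_eqI:
  assumes "module K V" "module K W" "module K U" "linear_map K (tensor_prod K V W) U G"
    and "\<And>v w. v \<in> carrier V \<Longrightarrow> w \<in> carrier W \<Longrightarrow> f v w = G (tensor K V W v w)"
    and "t \<in> carrier (tensor_prod K V W)"
  shows "tensor_lift K U f t = G t"
proof -
  have bil: "bilinear_map K V W U f"
    by (rule bilinear_map_cong[OF assms(1,2)
        bilinear_map_comp[OF bilinear_map_tensor linear_map_id linear_map_id assms(4)]])
      (use assms in auto)
  show ?thesis
    by (rule tensor_prod_ext[OF assms(1-3) linear_map_tensor_lift[OF assms(1-3) bil] assms(4) _ assms(6)])
      (simp add: tensor_lift_tensor[OF assms(1-3) bil] assms(5))
qed

lemma tensor_closed:
  assumes "module K V" "module K W" "v \<in> carrier V" "w \<in> carrier W"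
  shows "tensor K V W v w \<in> carrier (tensor_prod K V W)"
  using bilinear_map_tensor[OF assms(1,2)] assms(3,4) by (auto simp: bilinear_map_def linear_map_def)

lemma tensor_map:
  assumes "module K V" "module K W" "module K V'" "module K W'"
    and "linear_map K V V' f" "linear_map K W W' g"
  shows linear_map_tensor_map:
      "linear_map K (tensor_prod K V W) (tensor_prod K V' W') (tensor_map K V' W' f g)"
    and tensor_map_tensor: "v \<in> carrier V \<Longrightarrow> w \<in> carrier W \<Longrightarrow>
      tensor_map K V' W' f g (tensor K V W v w) = tensor K V' W' (f v) (g w)"
proof -
  have bil: "bilinear_map K V W (tensor_prod K V' W') (\<lambda>x y. tensor K V' W' (f x) (g y))"
    by (rule bilinear_map_comp[OF bilinear_map_tensor assms(5,6) linear_map_id]) fact+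
  note T = assms(1,2) module_tensor_prod[OF assms(3,4)] bil
  show "linear_map K (tensor_prod K V W) (tensor_prod K V' W') (tensor_map K V' W' f g)"
    unfolding tensor_map_def by (rule linear_map_tensor_lift[OF T])
  show "v \<in> carrier V \<Longrightarrow> w \<in> carrier W \<Longrightarrow>
      tensor_map K V' W' f g (tensor K V W v w) = tensor K V' W' (f v) (g w)"
    unfolding tensor_map_def by (rule tensor_lift_tensor[OF T])
qed

lemma tensor_slot_linear:
  assumes "module K V" "module K W"
  shows "w \<in> carrier W \<Longrightarrow> linear_map K V (tensor_prod K V W) (\<lambda>v. tensor K V W v w)"
    and "v \<in> carrier V \<Longrightarrow> linear_map K W (tensor_prod K V W) (tensor K V W v)"
  using bilinear_map_tensor[OF assms] by (auto simp: bilinear_map_def)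

text \<open>
  The universal property with a parameter: it makes the nested lifts defining the associativity maps
  bilinear. Linearity in the parameter is an equality of linear maps on \<open>V \<otimes> W\<close>, so it suffices to
  know it on pure tensors.
\<close>

lemma tensor_lift_param:
  assumes "module K U" "module K V" "module K W" "module K Z"
    and "\<And>u. u \<in> carrier U \<Longrightarrow> bilinear_map K V W Z (f u)"
    and "\<And>v w. v \<in> carrier V \<Longrightarrow> w \<in> carrier W \<Longrightarrow> linear_map K U Z (\<lambda>u. f u v w)"
  shows "bilinear_map K U (tensor_prod K V W) Z (\<lambda>u. tensor_lift K Z (f u))"
proof -
  interpret U: module K U by fact
  interpret V: module K V by fact
  interpret Z: module K Z by fact
  let ?T = "tensor_prod K V W"
  have L: "linear_map K ?T Z (tensor_lift K Z (f u))" if "u \<in> carrier U" for u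
    by (rule linear_map_tensor_lift[OF assms(2-4) assms(5)[OF that]])
  note D = linear_mapD[OF L]
  note v = tensor_lift_tensor[OF assms(2-4) assms(5)]
  have sums: "linear_map K ?T Z (\<lambda>t. tensor_lift K Z (f u) t \<oplus>\<^bsub>Z\<^esub> tensor_lift K Z (f u') t)"
    if "u \<in> carrier U" "u' \<in> carrier U" for u u'
    by (rule linear_mapI) (simp_all add: that D Z.smult_r_distr Z.M.a_ac)
  have scaled: "linear_map K ?T Z (\<lambda>t. c \<odot>\<^bsub>Z\<^esub> tensor_lift K Z (f u) t)"
    if "c \<in> carrier K" "u \<in> carrier U" for c u
    by (rule linear_mapI)
      (simp_all add: that D Z.smult_r_distr smult_left_commute[OF assms(4)])
  have "linear_map K U Z (\<lambda>u. tensor_lift K Z (f u) t)" if t: "t \<in> carrier ?T" for t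
  proof (rule linear_mapI)
    fix u assume u: "u \<in> carrier U"
    show "tensor_lift K Z (f u) t \<in> carrier Z" using D(1) u t by blast
    fix u' assume u': "u' \<in> carrier U"
    show "tensor_lift K Z (f (u \<oplus>\<^bsub>U\<^esub> u')) t = tensor_lift K Z (f u) t \<oplus>\<^bsub>Z\<^esub> tensor_lift K Z (f u') t"
      by (rule tensor_prod_ext[OF assms(2-4) L sums _ t])
        (use u u' in \<open>simp_all add: v linear_mapD(2)[OF assms(6)]\<close>)
  next
    fix c u assume c: "c \<in> carrier K" "u \<in> carrier U"
    show "tensor_lift K Z (f (c \<odot>\<^bsub>U\<^esub> u)) t = c \<odot>\<^bsub>Z\<^esub> tensor_lift K Z (f u) t"
      by (rule tensor_prod_ext[OF assms(2-4) L scaled _ t])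
        (use c in \<open>simp_all add: v linear_mapD(3)[OF assms(6)]\<close>)
  qed
  then show ?thesis using L by (simp add: bilinear_map_def)
qed

lemma
  assumes "module K U" "module K V" "module K W"
  shows linear_map_tensor_assoc: "linear_map K (tensor_prod K (tensor_prod K U V) W)
      (tensor_prod K U (tensor_prod K V W)) (tensor_assoc K U V W)"
    and tensor_assoc_tensor: "u \<in> carrier U \<Longrightarrow> v \<in> carrier V \<Longrightarrow> w \<in> carrier W \<Longrightarrow>
      tensor_assoc K U V W (tensor K (tensor_prod K U V) W (tensor K U V u v) w) =
      tensor K U (tensor_prod K V W) u (tensor K V W v w)"
proof -
  let ?VW = "tensor_prod K V W" and ?UV = "tensor_prod K U V"
  let ?Z = "tensor_prod K U ?VW"
  have VW: "module K ?VW" and UV: "module K ?UV" and Z: "module K ?Z"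
    by (intro module_tensor_prod assms)+
  let ?f = "\<lambda>w u v. tensor K U ?VW u (tensor K V W v w)"
  have bil: "bilinear_map K U V ?Z (?f w)" if "w \<in> carrier W" for w
    by (rule bilinear_map_comp[OF bilinear_map_tensor[OF assms(1) VW] linear_map_id
        tensor_slot_linear(1)[OF assms(2,3) that] linear_map_id])
  have lin: "linear_map K W ?Z (\<lambda>w. ?f w u v)" if "u \<in> carrier U" "v \<in> carrier V" for u v
    by (rule linear_map_comp[OF tensor_slot_linear(2)[OF assms(2,3)] tensor_slot_linear(2)[OF assms(1) VW]]) fact+
  have big: "bilinear_map K ?UV W ?Z (\<lambda>x w. tensor_lift K ?Z (?f w) x)"
    by (rule bilinear_map_flip[OF tensor_lift_param[OF assms(3,1,2) Z bil lin]])
  note T = UV assms(3) Z big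
  show "linear_map K (tensor_prod K ?UV W) ?Z (tensor_assoc K U V W)"
    unfolding tensor_assoc_def Let_def by (rule linear_map_tensor_lift[OF T])
  assume "u \<in> carrier U" "v \<in> carrier V" "w \<in> carrier W"
  then show "tensor_assoc K U V W (tensor K ?UV W (tensor K U V u v) w) =
      tensor K U ?VW u (tensor K V W v w)"
    unfolding tensor_assoc_def Let_def
    by (simp add: tensor_lift_tensor[OF T] tensor_lift_tensor[OF assms(1,2) Z bil] tensor_closed assms)
qed

lemma
  assumes "module K U" "module K V" "module K W"
  shows linear_map_tensor_assoc_inv: "linear_map K (tensor_prod K U (tensor_prod K V W))
      (tensor_prod K (tensor_prod K U V) W) (tensor_assoc_inv K U V W)"
    and tensor_assoc_inv_tensor: "u \<in> carrier U \<Longrightarrow> v \<in> carrier V \<Longrightarrow> w \<in> carrier W \<Longrightarrow>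
      tensor_assoc_inv K U V W (tensor K U (tensor_prod K V W) u (tensor K V W v w)) =
      tensor K (tensor_prod K U V) W (tensor K U V u v) w"
proof -
  let ?VW = "tensor_prod K V W" and ?UV = "tensor_prod K U V"
  let ?Z = "tensor_prod K ?UV W"
  have VW: "module K ?VW" and UV: "module K ?UV" and Z: "module K ?Z"
    by (intro module_tensor_prod assms)+
  let ?f = "\<lambda>u v w. tensor K ?UV W (tensor K U V u v) w"
  have bil: "bilinear_map K V W ?Z (?f u)" if "u \<in> carrier U" for u
    by (rule bilinear_map_comp[OF bilinear_map_tensor[OF UV assms(3)]
        tensor_slot_linear(2)[OF assms(1,2) that] linear_map_id linear_map_id])
  have lin: "linear_map K U ?Z (\<lambda>u. ?f u v w)" if "v \<in> carrier V" "w \<in> carrier W" for v w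
    by (rule linear_map_comp[OF tensor_slot_linear(1)[OF assms(1,2)] tensor_slot_linear(1)[OF UV assms(3)]]) fact+
  have big: "bilinear_map K U ?VW ?Z (\<lambda>u. tensor_lift K ?Z (?f u))"
    by (rule tensor_lift_param[OF assms Z bil lin])
  note T = assms(1) VW Z big
  show "linear_map K (tensor_prod K U ?VW) ?Z (tensor_assoc_inv K U V W)"
    unfolding tensor_assoc_inv_def Let_def by (rule linear_map_tensor_lift[OF T])
  assume "u \<in> carrier U" "v \<in> carrier V" "w \<in> carrier W"
  then show "tensor_assoc_inv K U V W (tensor K U ?VW u (tensor K V W v w)) =
      tensor K ?UV W (tensor K U V u v) w"
    unfolding tensor_assoc_inv_def Let_def
    by (simp add: tensor_lift_tensor[OF T] tensor_lift_tensor[OF assms(2,3) Z bil] tensor_closed assms)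
qed

lemma tensor_prod3_ext:
  assumes "module K U" "module K V" "module K W" "module K Z"
    and f: "linear_map K (tensor_prod K U (tensor_prod K V W)) Z f"
    and g: "linear_map K (tensor_prod K U (tensor_prod K V W)) Z g"
    and eq: "\<And>u v w. u \<in> carrier U \<Longrightarrow> v \<in> carrier V \<Longrightarrow> w \<in> carrier W \<Longrightarrow>
      f (tensor K U (tensor_prod K V W) u (tensor K V W v w)) =
      g (tensor K U (tensor_prod K V W) u (tensor K V W v w))"
    and X: "X \<in> carrier (tensor_prod K U (tensor_prod K V W))"
  shows "f X = g X"
proof (rule tensor_prod_ext[OF assms(1) module_tensor_prod[OF assms(2,3)] assms(4) f g _ X])
  fix u t assume u: "u \<in> carrier U" and t: "t \<in> carrier (tensor_prod K V W)"
  note slot = tensor_slot_linear(2)[OF assms(1) module_tensor_prod[OF assms(2,3)] u]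
  show "f (tensor K U (tensor_prod K V W) u t) = g (tensor K U (tensor_prod K V W) u t)"
    by (rule tensor_prod_ext[OF assms(2-4) linear_map_comp[OF slot f] linear_map_comp[OF slot g] _ t])
      (use eq u in blast)
qed


section \<open>A braid relation from word relations\<close>

text \<open>
  The braid relation for \<open>R = r P + s (Q - A)\<close> and \<open>L = r P' + s (Q' - A)\<close> as a consequence of
  relations between words. With \<open>X = Q - A\<close> and \<open>Y = Q' - A\<close> the hypotheses give
  \<open>P Y = X P = Y P' = 0\<close> and \<open>X P' = P' X\<close>, which kills three of the eight monomials on either side.
  What remains to be compared is, by decreasing degree in \<open>r\<close>:
  \<^item> \<open>P P' P = P' P P'\<close>, a hypothesis;
  \<^item> \<open>P P' X = Y P P' + P' P' X\<close>, where both sides are \<open>A Q P' - A P P'\<close>;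
  \<^item> \<open>P' X X + X Y P = P' X Y\<close>, where both sides are \<open>A X Q' - A X P'\<close>, since \<open>X\<^sup>2 = - A X\<close>;
  \<^item> \<open>X Y X = Y X Y\<close>, whose expansion is symmetric in \<open>Q\<close> and \<open>Q'\<close> up to \<open>Q Q' Q = Q' Q Q'\<close>.
\<close>

lemma braid_relation_of_words:
  assumes M: "module K M"
    and lin: "linear_map K M M P" "linear_map K M M Q" "linear_map K M M P'" "linear_map K M M Q'"
      "linear_map K M M A"
    and rs: "r \<in> carrier K" "s \<in> carrier K"
    and R: "\<And>x. x \<in> carrier M \<Longrightarrow> R x = r \<odot>\<^bsub>M\<^esub> P x \<oplus>\<^bsub>M\<^esub> s \<odot>\<^bsub>M\<^esub> Q x \<ominus>\<^bsub>M\<^esub> s \<odot>\<^bsub>M\<^esub> A x"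
    and L: "\<And>x. x \<in> carrier M \<Longrightarrow> L x = r \<odot>\<^bsub>M\<^esub> P' x \<oplus>\<^bsub>M\<^esub> s \<odot>\<^bsub>M\<^esub> Q' x \<ominus>\<^bsub>M\<^esub> s \<odot>\<^bsub>M\<^esub> A x"
    and central: "\<And>x. x \<in> carrier M \<Longrightarrow> P (A x) = A (P x)" "\<And>x. x \<in> carrier M \<Longrightarrow> Q (A x) = A (Q x)"
      "\<And>x. x \<in> carrier M \<Longrightarrow> P' (A x) = A (P' x)" "\<And>x. x \<in> carrier M \<Longrightarrow> Q' (A x) = A (Q' x)"
    and right: "\<And>x. x \<in> carrier M \<Longrightarrow> Q (P x) = A (P x)" "\<And>x. x \<in> carrier M \<Longrightarrow> P (Q x) = A (Q x)"
      "\<And>x. x \<in> carrier M \<Longrightarrow> Q (Q x) = A (Q x)"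
    and left: "\<And>x. x \<in> carrier M \<Longrightarrow> P' (P' x) = A (P' x)" "\<And>x. x \<in> carrier M \<Longrightarrow> P' (Q' x) = A (Q' x)"
      "\<And>x. x \<in> carrier M \<Longrightarrow> Q' (P' x) = A (P' x)" "\<And>x. x \<in> carrier M \<Longrightarrow> Q' (Q' x) = A (Q' x)"
    and mixed: "\<And>x. x \<in> carrier M \<Longrightarrow> P (Q' x) = A (P x)" "\<And>x. x \<in> carrier M \<Longrightarrow> Q' (P x) = A (Q' x)"
      "\<And>x. x \<in> carrier M \<Longrightarrow> Q (P' x) = P' (Q x)"
    and cubic: "\<And>x. x \<in> carrier M \<Longrightarrow> P (P' (P x)) = P' (P (P' x))"
      "\<And>x. x \<in> carrier M \<Longrightarrow> Q (Q' (Q x)) = Q' (Q (Q' x))"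
    and x: "x \<in> carrier M"
  shows "R (L (R x)) = L (R (L x))"
proof -
  interpret M: module K M by fact
  note D = linear_mapD[OF lin(1)] linear_mapD[OF lin(2)] linear_mapD[OF lin(3)]
    linear_mapD[OF lin(4)] linear_mapD[OF lin(5)]
  note diff = linear_map_minus[OF M M]
  note Dm = diff[OF lin(1)] diff[OF lin(2)] diff[OF lin(3)] diff[OF lin(4)] diff[OF lin(5)]
  define X where "X = (\<lambda>x. Q x \<ominus>\<^bsub>M\<^esub> A x)"
  define Y where "Y = (\<lambda>x. Q' x \<ominus>\<^bsub>M\<^esub> A x)"
  have linX: "linear_map K M M X" and linY: "linear_map K M M Y" unfolding X_def Y_def
    by (rule linear_mapI; simp add: D M.smult_r_distr a_minus_def M.M.minus_add M.M.a_ac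
        M.smult_r_minus)+
  note DXY = linear_mapD[OF linX] linear_mapD[OF linY]
  note DmXY = diff[OF linX] diff[OF linY]
  \<comment> \<open>Isolates the common coefficient of the last two terms, so that each operator becomes binomial.\<close>
  have split: "r \<odot>\<^bsub>M\<^esub> p \<oplus>\<^bsub>M\<^esub> s \<odot>\<^bsub>M\<^esub> q \<ominus>\<^bsub>M\<^esub> s \<odot>\<^bsub>M\<^esub> a = r \<odot>\<^bsub>M\<^esub> p \<oplus>\<^bsub>M\<^esub> s \<odot>\<^bsub>M\<^esub> (q \<ominus>\<^bsub>M\<^esub> a)"
    if "p \<in> carrier M" "q \<in> carrier M" "a \<in> carrier M" for p q a
    using that rs by (simp add: a_minus_def M.smult_r_distr M.smult_r_minus M.M.a_assoc)
  have RX: "R z = r \<odot>\<^bsub>M\<^esub> P z \<oplus>\<^bsub>M\<^esub> s \<odot>\<^bsub>M\<^esub> X z" and LY: "L z = r \<odot>\<^bsub>M\<^esub> P' z \<oplus>\<^bsub>M\<^esub> s \<odot>\<^bsub>M\<^esub> Y z"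
    if "z \<in> carrier M" for z
    using that by (simp_all add: R L X_def Y_def split D)
  have self_diff: "z \<ominus>\<^bsub>M\<^esub> z = \<zero>\<^bsub>M\<^esub>" if "z \<in> carrier M" for z
    using that by (simp add: a_minus_def M.M.r_neg)

  have zeros: "P (Y z) = \<zero>\<^bsub>M\<^esub>" "X (P z) = \<zero>\<^bsub>M\<^esub>" "Y (P' z) = \<zero>\<^bsub>M\<^esub>" "Q (X z) = \<zero>\<^bsub>M\<^esub>" "Q' (Y z) = \<zero>\<^bsub>M\<^esub>"
    if "z \<in> carrier M" for z
    using that by (simp_all add: X_def Y_def D Dm central right left mixed self_diff)
  have XP': "X (P' z) = P' (X z)" if "z \<in> carrier M" for z
    using that by (simp add: X_def D Dm central mixed)
  have XA: "X (A z) = A (X z)" and YA: "Y (A z) = A (Y z)" if "z \<in> carrier M" for z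
    using that by (simp_all add: X_def Y_def D Dm central)
  have XX: "X (X z) = \<ominus>\<^bsub>M\<^esub> A (X z)" and YY: "Y (Y z) = \<ominus>\<^bsub>M\<^esub> A (Y z)" if "z \<in> carrier M" for z
    using that zeros(4,5)[OF that] DXY(1)[OF that] DXY(4)[OF that]
    by (simp_all add: X_def[THEN fun_cong, of "X z"] Y_def[THEN fun_cong, of "Y z"] D a_minus_def)
  have neg: "f (\<ominus>\<^bsub>M\<^esub> z) = \<ominus>\<^bsub>M\<^esub> f z" if "linear_map K M M f" "z \<in> carrier M" for f z
    using diff[OF that(1), of "\<zero>\<^bsub>M\<^esub>" z] that linear_map_zero[OF M M that(1)] linear_mapD(1)[OF that]
    by (simp add: a_minus_def)

  have c2: "P (P' (X x)) = Y (P (P' x)) \<oplus>\<^bsub>M\<^esub> P' (P' (X x))"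
  proof -
    have telescope: "q \<ominus>\<^bsub>M\<^esub> p = (a \<ominus>\<^bsub>M\<^esub> p) \<oplus>\<^bsub>M\<^esub> (q \<ominus>\<^bsub>M\<^esub> a)"
      if "q \<in> carrier M" "p \<in> carrier M" "a \<in> carrier M" for q p a
      using that by (simp add: a_minus_def M.M.a_ac M.M.r_neg1 M.M.r_neg2)
    have e1: "P (P' (X x)) = A (Q (P' x)) \<ominus>\<^bsub>M\<^esub> A (P (P' x))"
      unfolding XP'[OF x, symmetric] unfolding X_def using x by (simp add: D Dm central right)
    have e2: "Y (P (P' x)) = A (A (P' x)) \<ominus>\<^bsub>M\<^esub> A (P (P' x))"
      unfolding Y_def using x by (simp add: D mixed left)
    have e3: "P' (P' (X x)) = A (Q (P' x)) \<ominus>\<^bsub>M\<^esub> A (A (P' x))"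
      using x by (simp add: D DXY left XP'[symmetric]) (simp add: X_def D Dm central)
    show ?thesis unfolding e1 e2 e3
      by (rule telescope) (use x in \<open>simp_all add: D\<close>)
  qed

  have c1: "P' (X (X x)) \<oplus>\<^bsub>M\<^esub> X (Y (P x)) = P' (X (Y x))"
  proof -
    have "P' (X (X x)) = \<ominus>\<^bsub>M\<^esub> A (X (P' x))"
      using x by (simp add: XX neg[OF lin(3)] D DXY central XP')
    moreover have "X (Y (P x)) = A (X (Q' x))"
    proof -
      have "Y (P x) = A (Q' x) \<ominus>\<^bsub>M\<^esub> A (P x)"
        unfolding Y_def using x by (simp add: D mixed)
      then show ?thesis using x
        by (simp add: D DXY DmXY XA zeros a_minus_def neg[OF linX] linear_map_zero[OF M M lin(5)])
    qed
    moreover have "P' (X (Y x)) = A (X (Q' x)) \<ominus>\<^bsub>M\<^esub> A (X (P' x))"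
    proof -
      have "P' (Y x) = A (Q' x) \<ominus>\<^bsub>M\<^esub> A (P' x)"
        unfolding Y_def using x by (simp add: D Dm left central)
      then show ?thesis using x by (simp add: D DXY DmXY XA XP'[symmetric])
    qed
    ultimately show ?thesis using x by (simp add: D DXY a_minus_def M.M.a_comm)
  qed

  have c0: "X (Y (X x)) = Y (X (Y x))"
  proof -
    have "X (Y (X x)) = X (Q' (X x)) \<oplus>\<^bsub>M\<^esub> A (A (X x))"
      using x by (simp add: Y_def[THEN fun_cong, of "X x"] D DXY DmXY XA XX
          neg[OF lin(5)] neg[OF linX] a_minus_def)
    moreover have "Y (X (Y x)) = Y (Q (Y x)) \<oplus>\<^bsub>M\<^esub> A (A (Y x))"
      using x by (simp add: X_def[THEN fun_cong, of "Y x"] D DXY DmXY YA YY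
          neg[OF lin(5)] neg[OF linY] a_minus_def)
    ultimately show ?thesis
      using x by (simp add: X_def Y_def D Dm central cubic a_minus_def neg[OF lin(1)] neg[OF lin(2)]
          neg[OF lin(3)] neg[OF lin(4)] neg[OF lin(5)] M.M.minus_add M.M.a_ac)
  qed

  \<comment> \<open>With the rule for \<open>X P'\<close> the primed letter moves outwards, so both sides reach the same words.\<close>
  note expand = RX LY D DXY M.smult_r_distr M.smult_assoc1[symmetric] M.R.m_ac M.M.a_ac zeros XP'
    linear_map_zero[OF M M lin(3)] linear_map_zero[OF M M linY] linear_map_zero[OF M M lin(1)]
  have "R (L (R x)) = (r \<otimes>\<^bsub>K\<^esub> (r \<otimes>\<^bsub>K\<^esub> r)) \<odot>\<^bsub>M\<^esub> P (P' (P x)) \<oplus>\<^bsub>M\<^esub>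
      (r \<otimes>\<^bsub>K\<^esub> (r \<otimes>\<^bsub>K\<^esub> s)) \<odot>\<^bsub>M\<^esub> P (P' (X x)) \<oplus>\<^bsub>M\<^esub>
      (r \<otimes>\<^bsub>K\<^esub> (s \<otimes>\<^bsub>K\<^esub> s)) \<odot>\<^bsub>M\<^esub> (P' (X (X x)) \<oplus>\<^bsub>M\<^esub> X (Y (P x))) \<oplus>\<^bsub>M\<^esub>
      (s \<otimes>\<^bsub>K\<^esub> (s \<otimes>\<^bsub>K\<^esub> s)) \<odot>\<^bsub>M\<^esub> X (Y (X x))"
    using x rs by (simp add: expand)
  moreover have "L (R (L x)) = (r \<otimes>\<^bsub>K\<^esub> (r \<otimes>\<^bsub>K\<^esub> r)) \<odot>\<^bsub>M\<^esub> P' (P (P' x)) \<oplus>\<^bsub>M\<^esub>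
      (r \<otimes>\<^bsub>K\<^esub> (r \<otimes>\<^bsub>K\<^esub> s)) \<odot>\<^bsub>M\<^esub> (Y (P (P' x)) \<oplus>\<^bsub>M\<^esub> P' (P' (X x))) \<oplus>\<^bsub>M\<^esub>
      (r \<otimes>\<^bsub>K\<^esub> (s \<otimes>\<^bsub>K\<^esub> s)) \<odot>\<^bsub>M\<^esub> P' (X (Y x)) \<oplus>\<^bsub>M\<^esub>
      (s \<otimes>\<^bsub>K\<^esub> (s \<otimes>\<^bsub>K\<^esub> s)) \<odot>\<^bsub>M\<^esub> Y (X (Y x))"
    using x rs by (simp add: expand)
  ultimately show ?thesis by (simp add: cubic(1)[OF x] c0 c1 c2)
qed


section \<open>Contractions and splittings of a Hom-coalgebra\<close>

context hom_coalgebra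
begin

abbreviation C2 where "C2 \<equiv> tensor_prod K C C"
abbreviation C3 where "C3 \<equiv> tensor_prod K C C2"
abbreviation tensor2 (infixr "\<otimes>\<^sub>2" 75) where "x \<otimes>\<^sub>2 y \<equiv> tensor K C C x y"
abbreviation tensor3 (infixr "\<otimes>\<^sub>3" 74) where "x \<otimes>\<^sub>3 t \<equiv> tensor K C C2 x t"
abbreviation assoc3 where "assoc3 t z \<equiv> tensor_assoc K C C C (tensor K C2 C t z)"

text \<open>
  The contractions and faces apply the counit to one tensor factor; the numbering of the faces refers
  to the factors of \<open>C \<otimes> (C \<otimes> C)\<close>. The splittings apply \<open>\<Delta>\<close> to one factor and \<open>\<alpha>\<close> to the other.
\<close>

definition twist2 where "twist2 = tensor_map K C C \<alpha> \<alpha>"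
definition twist3 where "twist3 = tensor_map K C C2 \<alpha> twist2"
definition contract_left where "contract_left = tensor_lift K C (\<lambda>a c. \<epsilon> a \<odot>\<^bsub>C\<^esub> c)"
definition contract_right where "contract_right = tensor_lift K C (\<lambda>a c. \<epsilon> c \<odot>\<^bsub>C\<^esub> a)"
definition face1 where "face1 = tensor_lift K C2 (\<lambda>a t. \<epsilon> a \<odot>\<^bsub>C2\<^esub> t)"
definition face2 where "face2 = tensor_map K C C (\<lambda>x. x) contract_left"
definition face3 where "face3 = tensor_map K C C (\<lambda>x. x) contract_right"
definition split_right where "split_right = tensor_map K C C2 \<alpha> \<Delta>"
definition split_left where "split_left = tensor_assoc K C C C \<circ> tensor_map K C2 C \<Delta> \<alpha>"

lemma module_C: "module K C" by (rule module_axioms)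
lemma module_C2: "module K C2" by (rule module_tensor_prod[OF module_C module_C])
lemma module_C3: "module K C3" by (rule module_tensor_prod[OF module_C module_C2])
lemma module_C21: "module K (tensor_prod K C2 C)" by (rule module_tensor_prod[OF module_C2 module_C])

lemmas modules = module_C module_C2 module_C3 module_C21

lemma counit_closed: "x \<in> carrier C \<Longrightarrow> \<epsilon> x \<in> carrier K"
  using linear_mapD(1)[OF linear_counit] by (simp add: self_module_def)

lemmas twist_closed = linear_mapD(1)[OF linear_twist]
lemmas comult_closed = linear_mapD(1)[OF linear_comult]
lemmas tensor2_closed = tensor_closed[OF module_C module_C]
lemmas tensor3_closed = tensor_closed[OF module_C module_C2]

lemmas slot2 = tensor_slot_linear[OF module_C module_C]
lemmas slot3 = tensor_slot_linear[OF module_C module_C2]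

lemmas bilinear_left = bilinear_map_functional_smult[OF module_C module_C linear_counit]
lemmas bilinear_right = bilinear_map_flip[OF bilinear_left]
lemmas bilinear_left2 = bilinear_map_functional_smult[OF module_C module_C2 linear_counit]

lemma linear_twist2: "linear_map K C2 C2 twist2"
  unfolding twist2_def by (rule linear_map_tensor_map) (rule modules linear_twist)+
lemma linear_twist3: "linear_map K C3 C3 twist3"
  unfolding twist3_def by (rule linear_map_tensor_map) (rule modules linear_twist linear_twist2)+
lemma linear_contract_left: "linear_map K C2 C contract_left"
  unfolding contract_left_def by (rule linear_map_tensor_lift) (rule modules bilinear_left)+
lemma linear_contract_right: "linear_map K C2 C contract_right"
  unfolding contract_right_def by (rule linear_map_tensor_lift) (rule modules bilinear_right)+
lemma linear_face1: "linear_map K C3 C2 face1"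
  unfolding face1_def by (rule linear_map_tensor_lift) (rule modules bilinear_left2)+
lemma linear_face2: "linear_map K C3 C2 face2"
  unfolding face2_def
  by (rule linear_map_tensor_map) (rule modules linear_map_id linear_contract_left)+
lemma linear_face3: "linear_map K C3 C2 face3"
  unfolding face3_def
  by (rule linear_map_tensor_map) (rule modules linear_map_id linear_contract_right)+
lemma linear_split_right: "linear_map K C2 C3 split_right"
  unfolding split_right_def
  by (rule linear_map_tensor_map) (rule modules linear_twist linear_comult)+
lemma linear_assoc: "linear_map K (tensor_prod K C2 C) C3 (tensor_assoc K C C C)"
  by (rule linear_map_tensor_assoc) (rule modules)+
lemma linear_split_left: "linear_map K C2 C3 split_left"
  unfolding split_left_def comp_def
  by (rule linear_map_comp[OF linear_map_tensor_map linear_assoc])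
    (rule modules linear_twist linear_comult)+

lemmas linear = linear_twist linear_comult linear_twist2 linear_twist3 linear_contract_left
  linear_contract_right linear_face1 linear_face2 linear_face3 linear_split_right linear_split_left

lemma linear_assoc3: "z \<in> carrier C \<Longrightarrow> linear_map K C2 C3 (\<lambda>t. assoc3 t z)"
  by (rule linear_map_comp[OF tensor_slot_linear(1)[OF module_C2 module_C] linear_assoc])

lemma assoc3_tensor:
  "x \<in> carrier C \<Longrightarrow> y \<in> carrier C \<Longrightarrow> z \<in> carrier C \<Longrightarrow> assoc3 (x \<otimes>\<^sub>2 y) z = x \<otimes>\<^sub>3 y \<otimes>\<^sub>2 z"
  by (rule tensor_assoc_tensor[OF module_C module_C module_C])

lemma twist2_tensor:
  "x \<in> carrier C \<Longrightarrow> y \<in> carrier C \<Longrightarrow> twist2 (x \<otimes>\<^sub>2 y) = \<alpha> x \<otimes>\<^sub>2 \<alpha> y"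
  unfolding twist2_def by (rule tensor_map_tensor) (rule modules linear_twist | assumption)+
lemma twist3_tensor:
  "x \<in> carrier C \<Longrightarrow> t \<in> carrier C2 \<Longrightarrow> twist3 (x \<otimes>\<^sub>3 t) = \<alpha> x \<otimes>\<^sub>3 twist2 t"
  unfolding twist3_def
  by (rule tensor_map_tensor) (rule modules linear_twist linear_twist2 | assumption)+
lemma contract_left_tensor:
  "x \<in> carrier C \<Longrightarrow> y \<in> carrier C \<Longrightarrow> contract_left (x \<otimes>\<^sub>2 y) = \<epsilon> x \<odot>\<^bsub>C\<^esub> y"
  unfolding contract_left_def
  by (rule tensor_lift_tensor) (rule modules bilinear_left | assumption)+
lemma contract_right_tensor:
  "x \<in> carrier C \<Longrightarrow> y \<in> carrier C \<Longrightarrow> contract_right (x \<otimes>\<^sub>2 y) = \<epsilon> y \<odot>\<^bsub>C\<^esub> x"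
  unfolding contract_right_def
  by (rule tensor_lift_tensor) (rule modules bilinear_right | assumption)+
lemma face1_tensor:
  "x \<in> carrier C \<Longrightarrow> t \<in> carrier C2 \<Longrightarrow> face1 (x \<otimes>\<^sub>3 t) = \<epsilon> x \<odot>\<^bsub>C2\<^esub> t"
  unfolding face1_def
  by (rule tensor_lift_tensor) (rule modules bilinear_left2 | assumption)+
lemma face2_tensor:
  "x \<in> carrier C \<Longrightarrow> t \<in> carrier C2 \<Longrightarrow> face2 (x \<otimes>\<^sub>3 t) = x \<otimes>\<^sub>2 contract_left t"
  unfolding face2_def
  by (rule tensor_map_tensor) (rule modules linear_map_id linear_contract_left | assumption)+
lemma face3_tensor:
  "x \<in> carrier C \<Longrightarrow> t \<in> carrier C2 \<Longrightarrow> face3 (x \<otimes>\<^sub>3 t) = x \<otimes>\<^sub>2 contract_right t"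
  unfolding face3_def
  by (rule tensor_map_tensor) (rule modules linear_map_id linear_contract_right | assumption)+
lemma split_right_tensor:
  "x \<in> carrier C \<Longrightarrow> y \<in> carrier C \<Longrightarrow> split_right (x \<otimes>\<^sub>2 y) = \<alpha> x \<otimes>\<^sub>3 \<Delta> y"
  unfolding split_right_def
  by (rule tensor_map_tensor) (rule modules linear_twist linear_comult | assumption)+
lemma split_left_tensor:
  "x \<in> carrier C \<Longrightarrow> y \<in> carrier C \<Longrightarrow> split_left (x \<otimes>\<^sub>2 y) = assoc3 (\<Delta> x) (\<alpha> y)"
  using tensor_map_tensor[OF module_C module_C module_C2 module_C linear_comult linear_twist]
  by (simp add: split_left_def)

lemmas evals = twist2_tensor twist3_tensor contract_left_tensor contract_right_tensor face1_tensor
  face2_tensor face3_tensor split_right_tensor split_left_tensor assoc3_tensor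

lemmas closed = counit_closed twist_closed comult_closed tensor2_closed tensor3_closed
  linear_mapD(1)[OF linear_twist2] linear_mapD(1)[OF linear_twist3]
  linear_mapD(1)[OF linear_contract_left] linear_mapD(1)[OF linear_contract_right]
  linear_mapD(1)[OF linear_face1] linear_mapD(1)[OF linear_face2] linear_mapD(1)[OF linear_face3]
  linear_mapD(1)[OF linear_split_right] linear_mapD(1)[OF linear_split_left]
  linear_mapD(1)[OF linear_assoc3]

lemmas scale = linear_mapD(3)[OF linear_twist] linear_mapD(3)[OF linear_comult]
  linear_mapD(3)[OF linear_twist2] linear_mapD(3)[OF linear_twist3]
  linear_mapD(3)[OF linear_contract_left] linear_mapD(3)[OF linear_contract_right]
  linear_mapD(3)[OF linear_face1] linear_mapD(3)[OF linear_face2] linear_mapD(3)[OF linear_face3]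
  linear_mapD(3)[OF linear_split_right] linear_mapD(3)[OF linear_split_left]
  linear_mapD(3)[OF linear_assoc3]
  linear_mapD(3)[OF slot2(1)] linear_mapD(3)[OF slot2(2)]
  linear_mapD(3)[OF slot3(1)] linear_mapD(3)[OF slot3(2)]

lemmas ext2 = tensor_prod_ext[OF module_C module_C]
lemmas ext3 = tensor_prod3_ext[OF module_C module_C module_C]

text \<open>
  The values of \<open>split_left\<close> on pure tensors have the form \<open>(\<Delta> x) \<otimes> \<alpha> y\<close>, rebracketed, where \<open>\<Delta> x\<close> need not be a pure
  tensor. For a fixed last factor both sides are linear in \<open>t\<close>, so pure tensors \<open>t\<close> suffice.
\<close>

lemma face_assoc3:
  assumes "t \<in> carrier C2" "z \<in> carrier C"
  shows "face1 (assoc3 t z) = contract_left t \<otimes>\<^sub>2 z"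
    and "face2 (assoc3 t z) = contract_right t \<otimes>\<^sub>2 z"
    and "face3 (assoc3 t z) = \<epsilon> z \<odot>\<^bsub>C2\<^esub> t"
    and "twist3 (assoc3 t z) = assoc3 (twist2 t) (\<alpha> z)"
proof -
  interpret C2: module K C2 by (rule module_C2)
  note l = linear_assoc3[OF assms(2)] and s = slot2(1)[OF assms(2)]
  show "face1 (assoc3 t z) = contract_left t \<otimes>\<^sub>2 z"
    by (rule ext2[OF module_C2 linear_map_comp[OF l linear_face1]
          linear_map_comp[OF linear_contract_left s] _ assms(1)])
      (simp add: evals closed scale assms)
  show "face2 (assoc3 t z) = contract_right t \<otimes>\<^sub>2 z"
    by (rule ext2[OF module_C2 linear_map_comp[OF l linear_face2]
          linear_map_comp[OF linear_contract_right s] _ assms(1)])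
      (simp add: evals closed scale assms)
  have "linear_map K C2 C2 (\<lambda>t. \<epsilon> z \<odot>\<^bsub>C2\<^esub> t)"
    using bilinear_left2 assms(2) by (simp add: bilinear_map_def)
  then show "face3 (assoc3 t z) = \<epsilon> z \<odot>\<^bsub>C2\<^esub> t"
    by (rule ext2[OF module_C2 linear_map_comp[OF l linear_face3] _ _ assms(1)])
      (simp add: evals closed scale assms)
  show "twist3 (assoc3 t z) = assoc3 (twist2 t) (\<alpha> z)"
    by (rule ext2[OF module_C3 linear_map_comp[OF l linear_twist3]
          linear_map_comp[OF linear_twist2 linear_assoc3[OF twist_closed[OF assms(2)]]] _ assms(1)])
      (simp add: evals closed scale assms)
qed

lemma comult_twist2: "x \<in> carrier C \<Longrightarrow> twist2 (\<Delta> x) = \<Delta> (\<alpha> x)"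
  by (simp add: twist2_def comult_twist)

lemma contract_comult:
  assumes "x \<in> carrier C"
  shows "contract_left (\<Delta> x) = \<alpha> x" "contract_right (\<Delta> x) = \<alpha> x"
  using assms by (simp_all add: contract_left_def contract_right_def counit_left counit_right)

lemma split_comult: "x \<in> carrier C \<Longrightarrow> split_left (\<Delta> x) = split_right (\<Delta> x)"
  by (simp add: split_left_def split_right_def hom_coassoc)

lemma contract_twist:
  assumes "t \<in> carrier C2"
  shows "contract_left (twist2 t) = \<alpha> (contract_left t)"
    and "contract_right (twist2 t) = \<alpha> (contract_right t)"
  by (rule ext2[OF module_C linear_map_comp linear_map_comp _ assms]; (rule linear)?;
      simp add: evals closed scale counit_twist)+

lemma face_twist:
  assumes "x \<in> carrier C3"
  shows "face1 (twist3 x) = twist2 (face1 x)"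
    and "face2 (twist3 x) = twist2 (face2 x)"
    and "face3 (twist3 x) = twist2 (face3 x)"
  by (rule ext3[OF module_C2 linear_map_comp linear_map_comp _ assms]; (rule linear)?;
      simp add: evals closed scale counit_twist)+

lemma split_twist:
  assumes "t \<in> carrier C2"
  shows "split_left (twist2 t) = twist3 (split_left t)"
    and "split_right (twist2 t) = twist3 (split_right t)"
  by (rule ext2[OF module_C3 linear_map_comp linear_map_comp _ assms]; (rule linear)?;
      simp add: evals closed scale face_assoc3 comult_twist2)+

text \<open>
  The heart of the matter. A face that hits one of the two halves of the split factor is absorbed by a
  counit axiom and leaves the twist; a face that hits the other factor commutes past the splitting.
\<close>

lemma face_split:
  assumes "t \<in> carrier C2"
  shows "face1 (split_left t) = twist2 t" "face2 (split_left t) = twist2 t"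
    and "face3 (split_left t) = \<Delta> (contract_right t)"
    and "face2 (split_right t) = twist2 t" "face3 (split_right t) = twist2 t"
    and "face1 (split_right t) = \<Delta> (contract_left t)"
proof -
  note by_tensors = ext2[OF module_C2 _ _ _ assms]
    and rules = evals closed scale face_assoc3 contract_comult counit_twist
  show "face1 (split_left t) = twist2 t"
    by (rule by_tensors[OF linear_map_comp[OF linear_split_left linear_face1] linear_twist2])
      (simp_all add: rules)
  show "face2 (split_left t) = twist2 t"
    by (rule by_tensors[OF linear_map_comp[OF linear_split_left linear_face2] linear_twist2])
      (simp_all add: rules)
  show "face3 (split_left t) = \<Delta> (contract_right t)"
    by (rule by_tensors[OF linear_map_comp[OF linear_split_left linear_face3] linear_map_comp[OF linear_contract_right linear_comult]])
      (simp_all add: rules)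
  show "face2 (split_right t) = twist2 t"
    by (rule by_tensors[OF linear_map_comp[OF linear_split_right linear_face2] linear_twist2])
      (simp_all add: rules)
  show "face3 (split_right t) = twist2 t"
    by (rule by_tensors[OF linear_map_comp[OF linear_split_right linear_face3] linear_twist2])
      (simp_all add: rules)
  show "face1 (split_right t) = \<Delta> (contract_left t)"
    by (rule by_tensors[OF linear_map_comp[OF linear_split_right linear_face1] linear_map_comp[OF linear_contract_left linear_comult]])
      (simp_all add: rules)
qed

text \<open>
  All six ways of removing two of three tensor factors, paired by the factor of \<open>C\<close> that survives.
\<close>

lemma contract_face:
  assumes "x \<in> carrier C3"
  shows "contract_left (face2 x) = contract_left (face1 x)"
    and "contract_right (face3 x) = contract_right (face2 x)"
    and "contract_right (face1 x) = contract_left (face3 x)"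
proof -
  show "contract_left (face2 x) = contract_left (face1 x)"
    by (rule ext3[OF module_C linear_map_comp linear_map_comp _ assms]; (rule linear)?;
      simp add: evals closed scale counit_twist smult_left_commute[OF module_C])
  show "contract_right (face3 x) = contract_right (face2 x)"
    by (rule ext3[OF module_C linear_map_comp linear_map_comp _ assms]; (rule linear)?;
      simp add: evals closed scale counit_twist smult_left_commute[OF module_C])
  show "contract_right (face1 x) = contract_left (face3 x)"
    by (rule ext3[OF module_C linear_map_comp linear_map_comp _ assms]; (rule linear)?;
      simp add: evals closed scale counit_twist smult_left_commute[OF module_C])
qed


section \<open>Yang-Baxter equation and invertibility\<close>

text \<open>
  The word relations needed here all arise by rewriting with the interaction of faces and splittings.
  For instance, \<open>P' Q\<close> equals \<open>split_left \<circ> \<Delta> \<circ> contract_left \<circ> face3\<close> and \<open>Q P'\<close> equals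
  \<open>split_right \<circ> \<Delta> \<circ> contract_right \<circ> face1\<close>; the two contractions leave the same middle factor, and
  coassociativity identifies the two splittings on \<open>\<Delta>\<close>.
\<close>

lemma braiding_yang_baxter:
  assumes rs: "r \<in> carrier K" "s \<in> carrier K"
    and linB: "linear_map K C2 C2 B"
    and B: "\<And>t. t \<in> carrier C2 \<Longrightarrow> B t = r \<odot>\<^bsub>C2\<^esub> \<Delta> (contract_left t) \<oplus>\<^bsub>C2\<^esub>
      s \<odot>\<^bsub>C2\<^esub> \<Delta> (contract_right t) \<ominus>\<^bsub>C2\<^esub> s \<odot>\<^bsub>C2\<^esub> twist2 t"
  shows "hybe_solution K C \<alpha> B"
proof -
  interpret C2: module K C2 by (rule module_C2)
  interpret C3: module K C3 by (rule module_C3)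
  let ?P = "\<lambda>x. split_right (face2 x)" and ?Q = "\<lambda>x. split_right (face3 x)"
    and ?P' = "\<lambda>x. split_left (face1 x)" and ?Q' = "\<lambda>x. split_left (face2 x)"
  have linP: "linear_map K C3 C3 ?P" "linear_map K C3 C3 ?Q" "linear_map K C3 C3 ?P'"
    "linear_map K C3 C3 ?Q'"
    by (rule linear_map_comp; rule linear)+
  have linear_of_slots:
    "f (r \<odot>\<^bsub>C2\<^esub> u \<oplus>\<^bsub>C2\<^esub> s \<odot>\<^bsub>C2\<^esub> v \<ominus>\<^bsub>C2\<^esub> s \<odot>\<^bsub>C2\<^esub> w) =
      r \<odot>\<^bsub>C3\<^esub> f u \<oplus>\<^bsub>C3\<^esub> s \<odot>\<^bsub>C3\<^esub> f v \<ominus>\<^bsub>C3\<^esub> s \<odot>\<^bsub>C3\<^esub> f w"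
    if "linear_map K C2 C3 f" "u \<in> carrier C2" "v \<in> carrier C2" "w \<in> carrier C2" for f u v w
    using that rs by (simp add: linear_map_minus[OF module_C2 module_C3 that(1)] linear_mapD[OF that(1)])
  have linR: "linear_map K C3 C3 (hybe_right K C \<alpha> B)"
    unfolding hybe_right_def
    by (rule linear_map_tensor_map) (rule modules linear_twist linB)+
  have R: "hybe_right K C \<alpha> B (x \<otimes>\<^sub>3 t) = \<alpha> x \<otimes>\<^sub>3 B t" if "x \<in> carrier C" "t \<in> carrier C2" for x t
    unfolding hybe_right_def
    by (rule tensor_map_tensor) (rule modules linear_twist linB that)+
  note assoc_inv = linear_map_tensor_assoc_inv[OF module_C module_C module_C]
  note B_twist = tensor_map[OF module_C2 module_C module_C2 module_C linB linear_twist]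
  have linL: "linear_map K C3 C3 (hybe_left K C \<alpha> B)"
    unfolding hybe_left_def comp_def
    by (rule linear_map_comp[OF assoc_inv linear_map_comp[OF B_twist(1) linear_assoc]])
  have L: "hybe_left K C \<alpha> B (x \<otimes>\<^sub>3 y \<otimes>\<^sub>2 z) = assoc3 (B (x \<otimes>\<^sub>2 y)) (\<alpha> z)"
    if "x \<in> carrier C" "y \<in> carrier C" "z \<in> carrier C" for x y z
    using that by (simp add: hybe_left_def B_twist(2) closed
        tensor_assoc_inv_tensor[OF module_C module_C module_C])
  have Rsum: "hybe_right K C \<alpha> B x = r \<odot>\<^bsub>C3\<^esub> ?P x \<oplus>\<^bsub>C3\<^esub> s \<odot>\<^bsub>C3\<^esub> ?Q x \<ominus>\<^bsub>C3\<^esub> s \<odot>\<^bsub>C3\<^esub> twist3 x"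
    if "x \<in> carrier C3" for x
    by (rule ext3[OF module_C3 linR
          linear_map_lincomb[OF module_C3 module_C3 linP(1,2) linear_twist3 rs rs(2)] _ that])
      (simp add: R B evals closed scale linear_of_slots[OF slot3(2)] rs)
  have Lsum: "hybe_left K C \<alpha> B x = r \<odot>\<^bsub>C3\<^esub> ?P' x \<oplus>\<^bsub>C3\<^esub> s \<odot>\<^bsub>C3\<^esub> ?Q' x \<ominus>\<^bsub>C3\<^esub> s \<odot>\<^bsub>C3\<^esub> twist3 x"
    if "x \<in> carrier C3" for x
  proof (rule ext3[OF module_C3 linL
          linear_map_lincomb[OF module_C3 module_C3 linP(3,4) linear_twist3 rs rs(2)] _ that])
    fix x y z assume xyz: "x \<in> carrier C" "y \<in> carrier C" "z \<in> carrier C"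
    have "B (x \<otimes>\<^sub>2 y) = r \<odot>\<^bsub>C2\<^esub> (\<epsilon> x \<odot>\<^bsub>C2\<^esub> \<Delta> y) \<oplus>\<^bsub>C2\<^esub> s \<odot>\<^bsub>C2\<^esub> (\<epsilon> y \<odot>\<^bsub>C2\<^esub> \<Delta> x)
      \<ominus>\<^bsub>C2\<^esub> s \<odot>\<^bsub>C2\<^esub> (\<alpha> x \<otimes>\<^sub>2 \<alpha> y)"
      using xyz by (simp add: B evals closed scale)
    then have "assoc3 (B (x \<otimes>\<^sub>2 y)) (\<alpha> z) =
        r \<odot>\<^bsub>C3\<^esub> (\<epsilon> x \<odot>\<^bsub>C3\<^esub> assoc3 (\<Delta> y) (\<alpha> z)) \<oplus>\<^bsub>C3\<^esub> s \<odot>\<^bsub>C3\<^esub> (\<epsilon> y \<odot>\<^bsub>C3\<^esub> assoc3 (\<Delta> x) (\<alpha> z))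
        \<ominus>\<^bsub>C3\<^esub> s \<odot>\<^bsub>C3\<^esub> (\<alpha> x \<otimes>\<^sub>3 \<alpha> y \<otimes>\<^sub>2 \<alpha> z)"
      using xyz linear_of_slots[OF linear_assoc3[OF twist_closed[OF xyz(3)]],
        of "\<epsilon> x \<odot>\<^bsub>C2\<^esub> \<Delta> y" "\<epsilon> y \<odot>\<^bsub>C2\<^esub> \<Delta> x" "\<alpha> x \<otimes>\<^sub>2 \<alpha> y"]
      by (simp only: closed C2.smult_closed scale assoc3_tensor)
    then show "hybe_left K C \<alpha> B (x \<otimes>\<^sub>3 y \<otimes>\<^sub>2 z) = r \<odot>\<^bsub>C3\<^esub> ?P' (x \<otimes>\<^sub>3 y \<otimes>\<^sub>2 z) \<oplus>\<^bsub>C3\<^esub>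
       s \<odot>\<^bsub>C3\<^esub> ?Q' (x \<otimes>\<^sub>3 y \<otimes>\<^sub>2 z) \<ominus>\<^bsub>C3\<^esub> s \<odot>\<^bsub>C3\<^esub> twist3 (x \<otimes>\<^sub>3 y \<otimes>\<^sub>2 z)"
      using xyz by (simp add: L evals closed scale)
  qed
  have YB: "hybe_right K C \<alpha> B (hybe_left K C \<alpha> B (hybe_right K C \<alpha> B x)) =
      hybe_left K C \<alpha> B (hybe_right K C \<alpha> B (hybe_left K C \<alpha> B x))"
    if "x \<in> carrier C3" for x
    by (rule braid_relation_of_words[where M = C3 and P = ?P and Q = ?Q and P' = ?P' and Q' = ?Q'
          and A = twist3, OF module_C3 linP linear_twist3 rs Rsum Lsum _ _ _ _ _ _ _
          _ _ _ _ _ _ _ _ _ that])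
      (simp_all add: closed face_twist split_twist face_split contract_face split_comult
        comult_twist2 contract_twist)
  have comm: "twist2 (B t) = B (twist2 t)" if "t \<in> carrier C2" for t
    using that rs
    by (simp add: B closed linear_map_minus[OF module_C2 module_C2 linear_twist2]
        linear_mapD[OF linear_twist2] comult_twist2 contract_twist)
  show ?thesis unfolding hybe_solution_def
    using linear_twist linB YB comm by (simp add: twist2_def)
qed

text \<open>
  With \<open>E\<close>, \<open>E'\<close> and \<open>A\<close> as in the introduction, the product of \<open>p E + q E' - s A\<close> and
  \<open>p' E + q' E' - s' A\<close> is a combination of \<open>A E\<close>, \<open>A E'\<close> and \<open>A\<^sup>2 = 1\<close>; the conditions on the
  coefficients say that the first two cancel and that the third has coefficient \<open>1\<close>.
  They are stated without subtraction, each side collecting the terms of one sign.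
\<close>

lemma braiding_composite_id:
  assumes coeffs: "p \<in> carrier K" "q \<in> carrier K" "s \<in> carrier K"
      "p' \<in> carrier K" "q' \<in> carrier K" "s' \<in> carrier K"
    and vanish_left: "p \<otimes> p' \<oplus> q \<otimes> p' = p \<otimes> s' \<oplus> s \<otimes> p'"
    and vanish_right: "p \<otimes> q' \<oplus> q \<otimes> q' = q \<otimes> s' \<oplus> s \<otimes> q'"
    and unit: "s \<otimes> s' = \<one>"
    and involutive: "\<And>c. c \<in> carrier C \<Longrightarrow> \<alpha> (\<alpha> c) = c"
    and linG: "linear_map K C2 C2 G"
    and G: "\<And>t. t \<in> carrier C2 \<Longrightarrow> G t = p \<odot>\<^bsub>C2\<^esub> \<Delta> (contract_left t) \<oplus>\<^bsub>C2\<^esub>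
      q \<odot>\<^bsub>C2\<^esub> \<Delta> (contract_right t) \<ominus>\<^bsub>C2\<^esub> s \<odot>\<^bsub>C2\<^esub> twist2 t"
    and H: "\<And>t. t \<in> carrier C2 \<Longrightarrow> H t = p' \<odot>\<^bsub>C2\<^esub> \<Delta> (contract_left t) \<oplus>\<^bsub>C2\<^esub>
      q' \<odot>\<^bsub>C2\<^esub> \<Delta> (contract_right t) \<ominus>\<^bsub>C2\<^esub> s' \<odot>\<^bsub>C2\<^esub> twist2 t"
    and t: "t \<in> carrier C2"
  shows "G (H t) = t"
proof -
  interpret C2: module K C2 by (rule module_C2)
  have twist2_twist2: "twist2 (twist2 t) = t"
    by (rule ext2[OF module_C2 linear_map_comp[OF linear_twist2 linear_twist2] linear_map_id _ t])
      (simp add: evals closed involutive)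
  let ?u = "\<Delta> (\<alpha> (contract_left t))" and ?v = "\<Delta> (\<alpha> (contract_right t))"
  have uv: "?u \<in> carrier C2" "?v \<in> carrier C2" using t by (simp_all add: closed)
  have Gu: "G (\<Delta> (contract_left t)) = (p \<oplus> q) \<odot>\<^bsub>C2\<^esub> ?u \<ominus>\<^bsub>C2\<^esub> s \<odot>\<^bsub>C2\<^esub> ?u"
    and Gv: "G (\<Delta> (contract_right t)) = (p \<oplus> q) \<odot>\<^bsub>C2\<^esub> ?v \<ominus>\<^bsub>C2\<^esub> s \<odot>\<^bsub>C2\<^esub> ?v"
    and Gt: "G (twist2 t) = p \<odot>\<^bsub>C2\<^esub> ?u \<oplus>\<^bsub>C2\<^esub> q \<odot>\<^bsub>C2\<^esub> ?v \<ominus>\<^bsub>C2\<^esub> s \<odot>\<^bsub>C2\<^esub> t"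
    using t coeffs by (simp_all add: G closed contract_comult comult_twist2 contract_twist
        twist2_twist2 C2.smult_l_distr)
  have "G (H t) = p' \<odot>\<^bsub>C2\<^esub> G (\<Delta> (contract_left t)) \<oplus>\<^bsub>C2\<^esub> q' \<odot>\<^bsub>C2\<^esub> G (\<Delta> (contract_right t))
      \<ominus>\<^bsub>C2\<^esub> s' \<odot>\<^bsub>C2\<^esub> G (twist2 t)"
    using t coeffs
    by (simp add: H closed linear_map_minus[OF module_C2 module_C2 linG] linear_mapD[OF linG])
  also have "\<dots> = (p \<otimes> p' \<oplus> q \<otimes> p') \<odot>\<^bsub>C2\<^esub> ?u \<ominus>\<^bsub>C2\<^esub> (p \<otimes> s' \<oplus> s \<otimes> p') \<odot>\<^bsub>C2\<^esub> ?u \<oplus>\<^bsub>C2\<^esub>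
      ((p \<otimes> q' \<oplus> q \<otimes> q') \<odot>\<^bsub>C2\<^esub> ?v \<ominus>\<^bsub>C2\<^esub> (q \<otimes> s' \<oplus> s \<otimes> q') \<odot>\<^bsub>C2\<^esub> ?v) \<oplus>\<^bsub>C2\<^esub> (s \<otimes> s') \<odot>\<^bsub>C2\<^esub> t"
    unfolding Gu Gv Gt using t uv coeffs
    by (simp add: a_minus_def C2.smult_l_distr C2.smult_r_distr C2.smult_r_minus
        C2.M.minus_add C2.smult_assoc1[symmetric] m_ac C2.M.a_ac)
  also have "\<dots> = t"
    unfolding vanish_left vanish_right unit using t uv coeffs
    by (simp add: a_minus_def C2.M.r_neg)
  finally show ?thesis .
qed

end

theorem theorem3p4:
  fixes K :: "('a, 'm) ring_scheme"
    and C :: "('a, 'c, 'n) module_scheme"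
    and \<Delta> :: "'c \<Rightarrow> ('c \<times> 'c \<Rightarrow> 'a) set"
    and \<epsilon> :: "'c \<Rightarrow> 'a"
    and \<alpha> :: "'c \<Rightarrow> 'c"
    and \<mu> \<nu> :: 'a
    and T :: "('a, ('c \<times> 'c \<Rightarrow> 'a) set) module"
    and b b' :: "'c \<Rightarrow> 'c \<Rightarrow> ('c \<times> 'c \<Rightarrow> 'a) set"
    and B B' :: "('c \<times> 'c \<Rightarrow> 'a) set \<Rightarrow> ('c \<times> 'c \<Rightarrow> 'a) set"
  assumes "hom_coalgebra K C \<Delta> \<epsilon> \<alpha>"
    and "\<mu> \<in> carrier K" and "\<nu> \<in> carrier K"
    and "T = tensor_prod K C C"
    and "b = (\<lambda>x y. (\<mu> \<otimes>\<^bsub>K\<^esub> \<epsilon> x) \<odot>\<^bsub>T\<^esub> \<Delta> y \<oplus>\<^bsub>T\<^esub> (\<nu> \<otimes>\<^bsub>K\<^esub> \<epsilon> y) \<odot>\<^bsub>T\<^esub> \<Delta> x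
                  \<ominus>\<^bsub>T\<^esub> \<nu> \<odot>\<^bsub>T\<^esub> tensor K C C (\<alpha> x) (\<alpha> y))"
    and "b' = (\<lambda>x y. (inv\<^bsub>K\<^esub> \<nu> \<otimes>\<^bsub>K\<^esub> \<epsilon> x) \<odot>\<^bsub>T\<^esub> \<Delta> y \<oplus>\<^bsub>T\<^esub> (inv\<^bsub>K\<^esub> \<mu> \<otimes>\<^bsub>K\<^esub> \<epsilon> y) \<odot>\<^bsub>T\<^esub> \<Delta> x
                   \<ominus>\<^bsub>T\<^esub> inv\<^bsub>K\<^esub> \<nu> \<odot>\<^bsub>T\<^esub> tensor K C C (\<alpha> x) (\<alpha> y))"
    and "B = tensor_lift K T b" and "B' = tensor_lift K T b'"
  shows "(\<forall>x\<in>carrier C. \<forall>y\<in>carrier C. B (tensor K C C x y) = b x y) \<and>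
    hybe_solution K C \<alpha> B \<and>
    (\<mu> \<noteq> \<zero>\<^bsub>K\<^esub> \<and> \<nu> \<noteq> \<zero>\<^bsub>K\<^esub> \<and> (\<forall>c\<in>carrier C. \<alpha> (\<alpha> c) = c) \<longrightarrow>
      linear_map K T T B' \<and>
      (\<forall>x\<in>carrier C. \<forall>y\<in>carrier C. B' (tensor K C C x y) = b' x y) \<and>
      bij_betw B (carrier T) (carrier T) \<and>
      (\<forall>t\<in>carrier T. B' (B t) = t \<and> B (B' t) = t))"
proof -
  interpret hom_coalgebra K C \<Delta> \<epsilon> \<alpha> by fact
  note coeffs = assms(2,3) and T = assms(4)
  interpret C2: module K C2 by (rule module_C2)
  \<comment> \<open>Three independent coefficients, so that the same family contains both \<open>B\<close> and \<open>B'\<close>.\<close>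
  define G where "G = (\<lambda>p q s t. p \<odot>\<^bsub>C2\<^esub> \<Delta> (contract_left t) \<oplus>\<^bsub>C2\<^esub>
    q \<odot>\<^bsub>C2\<^esub> \<Delta> (contract_right t) \<ominus>\<^bsub>C2\<^esub> s \<odot>\<^bsub>C2\<^esub> twist2 t)"
  have linG: "linear_map K C2 C2 (G p q s)"
    if "p \<in> carrier K" "q \<in> carrier K" "s \<in> carrier K" for p q s
    unfolding G_def
    by (rule linear_map_lincomb[OF module_C2 module_C2
          linear_map_comp[OF linear_contract_left linear_comult]
          linear_map_comp[OF linear_contract_right linear_comult] linear_twist2 that])
  have G_tensor: "(p \<otimes>\<^bsub>K\<^esub> \<epsilon> x) \<odot>\<^bsub>C2\<^esub> \<Delta> y \<oplus>\<^bsub>C2\<^esub> (q \<otimes>\<^bsub>K\<^esub> \<epsilon> y) \<odot>\<^bsub>C2\<^esub> \<Delta> x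
      \<ominus>\<^bsub>C2\<^esub> s \<odot>\<^bsub>C2\<^esub> (\<alpha> x \<otimes>\<^sub>2 \<alpha> y) = G p q s (x \<otimes>\<^sub>2 y)"
    if "p \<in> carrier K" "q \<in> carrier K" "x \<in> carrier C" "y \<in> carrier C" for p q s x y
    using that by (simp add: G_def evals closed scale C2.smult_assoc1)
  have b: "b x y = G \<mu> \<nu> \<nu> (x \<otimes>\<^sub>2 y)" if "x \<in> carrier C" "y \<in> carrier C" for x y
    unfolding assms(5) T by (rule G_tensor) (use coeffs that in auto)
  have B: "B t = G \<mu> \<nu> \<nu> t" if "t \<in> carrier C2" for t
    unfolding assms(7) T
    by (rule tensor_lift_eqI[OF module_C module_C module_C2 linG b that]) (use coeffs in auto)
  have linB: "linear_map K C2 C2 B"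
    by (rule linear_map_cong[OF module_C2 linG B]) (use coeffs in auto)
  have eval: "\<forall>x\<in>carrier C. \<forall>y\<in>carrier C. B (x \<otimes>\<^sub>2 y) = b x y"
    by (simp add: B b closed)
  have solution: "hybe_solution K C \<alpha> B"
    by (rule braiding_yang_baxter[OF coeffs linB]) (simp add: B G_def)
  have inverse: "linear_map K T T B' \<and>
      (\<forall>x\<in>carrier C. \<forall>y\<in>carrier C. B' (x \<otimes>\<^sub>2 y) = b' x y) \<and>
      bij_betw B (carrier T) (carrier T) \<and>
      (\<forall>t\<in>carrier T. B' (B t) = t \<and> B (B' t) = t)"
    if nz: "\<mu> \<noteq> \<zero>\<^bsub>K\<^esub>" "\<nu> \<noteq> \<zero>\<^bsub>K\<^esub>" and involutive: "\<forall>c\<in>carrier C. \<alpha> (\<alpha> c) = c"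
  proof -
    let ?m = "inv\<^bsub>K\<^esub> \<mu>" and ?n = "inv\<^bsub>K\<^esub> \<nu>"
    have units: "\<mu> \<in> Units K" "\<nu> \<in> Units K" using coeffs nz by (simp_all add: field_Units)
    note inv = Units_inv_closed[OF units(1)] Units_inv_closed[OF units(2)]
      Units_l_inv[OF units(1)] Units_l_inv[OF units(2)]
      Units_r_inv[OF units(1)] Units_r_inv[OF units(2)]
    have b': "b' x y = G ?n ?m ?n (x \<otimes>\<^sub>2 y)" if "x \<in> carrier C" "y \<in> carrier C" for x y
      unfolding assms(6) T by (rule G_tensor) (use inv that in auto)
    have B': "B' t = G ?n ?m ?n t" if "t \<in> carrier C2" for t
      unfolding assms(8) T
      by (rule tensor_lift_eqI[OF module_C module_C module_C2 linG b' that]) (use inv in auto)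
    have linB': "linear_map K C2 C2 B'"
      by (rule linear_map_cong[OF module_C2 linG B']) (use inv in auto)
    have add_commute: "x \<oplus>\<^bsub>K\<^esub> y = y \<oplus>\<^bsub>K\<^esub> x" if "x \<in> carrier K" "y \<in> carrier K" for x y
      using that by (rule abelian_monoid.a_comm[OF abelian_group.axioms(1)[OF is_abelian_group]])
    have B'B: "B' (B t) = t" if "t \<in> carrier C2" for t
      by (rule braiding_composite_id[where p = ?n and q = ?m and s = ?n and p' = \<mu> and q' = \<nu> and s' = \<nu>,
            OF _ _ _ _ _ _ _ _ _ _ linB' B'[unfolded G_def] B[unfolded G_def] that])
        (use coeffs inv involutive in \<open>simp_all add: m_comm add_commute\<close>)
    have BB': "B (B' t) = t" if "t \<in> carrier C2" for t
      by (rule braiding_composite_id[where p = \<mu> and q = \<nu> and s = \<nu> and p' = ?n and q' = ?m and s' = ?n,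
            OF _ _ _ _ _ _ _ _ _ _ linB B[unfolded G_def] B'[unfolded G_def] that])
        (use coeffs inv involutive in \<open>simp_all add: m_comm add_commute\<close>)
    have "bij_betw B (carrier C2) (carrier C2)"
      by (rule bij_betw_byWitness[where f' = B'])
        (use B'B BB' linear_mapD(1)[OF linB] linear_mapD(1)[OF linB'] in auto)
    then show ?thesis unfolding T using linB' B'B BB' by (simp add: B' b' closed)
  qed
  show ?thesis
    by (rule conjI[OF eval conjI[OF solution impI]], elim conjE, rule inverse)
qed

end
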